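(* Let $W=(V,\mathsf{w})$ be a weighted digraph of positive spectral radius and of height $h$. 1. The subexponential degree of $W$ is $h-1$. 2. Let $\Theta$ be the residual matrix of $W$. Then, for $x,y\in V$, $[\Theta]_{x,y}>0$ if and only if there exists a dominant chain $(L_1,\dots,L_h)$ such that $x\Rightarrow L_1$ and $L_h\Rightarrow y$.
   Context: A weighted digraph is a pair $W=(V,\mathsf{w})$ with $V$ a finite set of vertices and $\mathsf{w}:V\times V\to\mathbb{R}_{\ge0}$; its edges are the pairs $(x,y)$ with $\mathsf{w}(x,y)>0$. Its adjacency matrix $F$ is given by $[F]_{x,y}=\mathsf{w}(x,y)$, and its spectral radius $\rho(W)$ is that of $F$. For vertices $x,y$, write $x\Rightarrow y$ ($x$ has access to $y$) if there is a finite path (possibly of length $0$) from $x$ to $y$ along edges. The access classes of $W$ are the equivalence classes of "$x\Rightarrow y$ and $y\Rightarrow x$"; the set $\mathcal{D}$ of access classes is partially ordered by the relation, still denoted $\Rightarrow$, induced by access. For a class $L$, $x\Rightarrow L$ (resp. $L\Rightarrow y$) means that $x$ has access to the vertices of $L$ (resp. that the vertices of $L$ have access to $y$). The spectral radius of an access class is that of the corresponding square block of $F$; a class is basic if its spectral radius equals $\rho(W)$. A dominant chain is a chain $L_1\Rightarrow L_2\Rightarrow\cdots$ of pairwise distinct basic classes in $(\mathcal{D},\Rightarrow)$ of maximal length, the length being the number of classes in the chain. The height of $W$ is the length of the dominant chains. The growth matrix of $W$ is $\mathsf{H}(z)=\sum_{k\ge0}F^kz^k$. If $\rho=\rho(W)>0$,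 there are a unique positive integer $m$ and a unique nonnegative nonzero matrix $\Theta$ such that $\lim_{s\to\rho^{-1},\,s\in(0,\rho^{-1})}(1-\rho s)^m\mathsf{H}(s)=\Theta$; $\Theta$ is called the residual matrix of $W$ and $m-1$ the subexponential degree of $W$. *)

theory Defs
  imports
    "HOL-Analysis.Analysis"
    "HOL-Library.Countable_Set"
    "Jordan_Normal_Form.Spectral_Radius"
begin

text \<open>
  The weight is a total function on the vertex type; only its values on \<open>V \<times> V\<close> are ever used.
\<close>

definition weighted_digraph :: "'v set \<Rightarrow> ('v \<Rightarrow> 'v \<Rightarrow> real) \<Rightarrow> bool" where
  "weighted_digraph V w \<longleftrightarrow> finite V \<and> (\<forall>x\<in>V. \<forall>y\<in>V. 0 \<le> w x y)"

text \<open>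
  Library matrices are indexed by \<open>{0..<n}\<close>. A matrix whose rows and columns are indexed by a
  finite set \<open>S\<close> is encoded through the library enumeration \<^term>\<open>from_nat_into S\<close>, which for
  finite \<open>S\<close> is a bijection from \<open>{..<card S}\<close> onto \<open>S\<close> with inverse \<^term>\<open>to_nat_on S\<close>;
  \<open>mat_entry S A x y\<close> is the entry of \<open>A\<close> at \<open>x, y \<in> S\<close>. For \<open>L \<subseteq> V\<close>, the square block of
  \<open>adj_mat V w\<close> indexed by \<open>L\<close> is \<open>adj_mat L w\<close> (up to a simultaneous reordering of its rows
  and columns).
\<close>

definition adj_mat :: "'v set \<Rightarrow> ('v \<Rightarrow> 'v \<Rightarrow> real) \<Rightarrow> real mat" where
  "adj_mat S w =
    mat (card S) (card S) (\<lambda>(i, j). w (from_nat_into S i) (from_nat_into S j))"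

definition mat_entry :: "'v set \<Rightarrow> 'b mat \<Rightarrow> 'v \<Rightarrow> 'v \<Rightarrow> 'b" where
  "mat_entry S A x y = A $$ (to_nat_on S x, to_nat_on S y)"

text \<open>
  \<^const>\<open>spectral_radius\<close> is the maximal modulus of a complex eigenvalue, which is unspecified for
  the \<open>0 \<times> 0\<close> matrix; by convention the spectral radius of the latter is \<open>0\<close> here.
\<close>

definition graph_radius :: "'v set \<Rightarrow> ('v \<Rightarrow> 'v \<Rightarrow> real) \<Rightarrow> real" where
  "graph_radius S w =
    (if S = {} then 0 else spectral_radius (map_mat complex_of_real (adj_mat S w)))"

definition edges :: "'v set \<Rightarrow> ('v \<Rightarrow> 'v \<Rightarrow> real) \<Rightarrow> ('v \<times> 'v) set" where
  "edges V w = {(x, y). x \<in> V \<and> y \<in> V \<and> 0 < w x y}"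

definition has_access :: "'v set \<Rightarrow> ('v \<Rightarrow> 'v \<Rightarrow> real) \<Rightarrow> 'v \<Rightarrow> 'v \<Rightarrow> bool" where
  "has_access V w x y \<longleftrightarrow> x \<in> V \<and> y \<in> V \<and> (x, y) \<in> (edges V w)\<^sup>*"

definition access_classes :: "'v set \<Rightarrow> ('v \<Rightarrow> 'v \<Rightarrow> real) \<Rightarrow> 'v set set" where
  "access_classes V w = V // {(x, y). has_access V w x y \<and> has_access V w y x}"

definition class_access :: "'v set \<Rightarrow> ('v \<Rightarrow> 'v \<Rightarrow> real) \<Rightarrow> 'v set \<Rightarrow> 'v set \<Rightarrow> bool" where
  "class_access V w L M \<longleftrightarrow> (\<forall>x\<in>L. \<forall>y\<in>M. has_access V w x y)"

definition basic_class :: "'v set \<Rightarrow> ('v \<Rightarrow> 'v \<Rightarrow> real) \<Rightarrow> 'v set \<Rightarrow> bool" where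
  "basic_class V w L \<longleftrightarrow> L \<in> access_classes V w \<and> graph_radius L w = graph_radius V w"

definition basic_chain :: "'v set \<Rightarrow> ('v \<Rightarrow> 'v \<Rightarrow> real) \<Rightarrow> 'v set list \<Rightarrow> bool" where
  "basic_chain V w Ls \<longleftrightarrow>
    Ls \<noteq> [] \<and> distinct Ls \<and> (\<forall>L\<in>set Ls. basic_class V w L) \<and>
    successively (class_access V w) Ls"

definition dominant_chain :: "'v set \<Rightarrow> ('v \<Rightarrow> 'v \<Rightarrow> real) \<Rightarrow> 'v set list \<Rightarrow> bool" where
  "dominant_chain V w Ls \<longleftrightarrow>
    basic_chain V w Ls \<and> (\<forall>Ms. basic_chain V w Ms \<longrightarrow> length Ms \<le> length Ls)"

definition height :: "'v set \<Rightarrow> ('v \<Rightarrow> 'v \<Rightarrow> real) \<Rightarrow> nat" where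
  "height V w = (THE h. \<exists>Ls. dominant_chain V w Ls \<and> length Ls = h)"

text \<open>
  The growth matrix is only needed at real arguments \<open>s\<close> with \<open>0 < s < 1 / graph_radius V w\<close>,
  where the series converge.
\<close>

definition growth_mat :: "'v set \<Rightarrow> ('v \<Rightarrow> 'v \<Rightarrow> real) \<Rightarrow> real \<Rightarrow> real mat" where
  "growth_mat V w s =
    mat (card V) (card V) (\<lambda>(i, j). \<Sum>k. (adj_mat V w ^\<^sub>m k) $$ (i, j) * s ^ k)"

definition is_residual ::
    "'v set \<Rightarrow> ('v \<Rightarrow> 'v \<Rightarrow> real) \<Rightarrow> nat \<Rightarrow> real mat \<Rightarrow> bool" where
  "is_residual V w m \<Theta> \<longleftrightarrow>
    0 < m \<and> \<Theta> \<in> carrier_mat (card V) (card V) \<and>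
    (\<forall>i<card V. \<forall>j<card V. 0 \<le> \<Theta> $$ (i, j)) \<and> \<Theta> \<noteq> 0\<^sub>m (card V) (card V) \<and>
    (\<forall>i<card V. \<forall>j<card V.
      ((\<lambda>s. (1 - graph_radius V w * s) ^ m * growth_mat V w s $$ (i, j)) \<longlongrightarrow> \<Theta> $$ (i, j))
        (at (1 / graph_radius V w) within {0<..<1 / graph_radius V w}))"

definition residual_mat :: "'v set \<Rightarrow> ('v \<Rightarrow> 'v \<Rightarrow> real) \<Rightarrow> real mat" where
  "residual_mat V w = (THE \<Theta>. \<exists>m. is_residual V w m \<Theta>)"

definition subexp_degree :: "'v set \<Rightarrow> ('v \<Rightarrow> 'v \<Rightarrow> real) \<Rightarrow> nat" where
  "subexp_degree V w = (THE m. \<exists>\<Theta>. is_residual V w m \<Theta>) - 1"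

end

theory Submission
  imports Defs
begin

text \<open>
  Write \<open>H s\<close> for the growth matrix and \<open>\<rho>\<close> for the spectral radius, with \<open>s < 1 / \<rho>\<close>. If \<open>x\<close>
  has access to \<open>z\<close>, then \<open>H s x y\<close> dominates a constant multiple of \<open>H s z y\<close> near \<open>1 / \<rho>\<close>, so all
  entries belonging to one access class have the same order of magnitude. This order is
  \<open>1 / (1 - \<rho> s)\<close> for a basic class: the diagonal weights of \<open>k\<close>-walks are supermultiplicative in
  \<open>k\<close>, hence at most \<open>\<rho> ^ k\<close>, while a dominant eigenvector of the block yields a row of it whose
  sum is at least \<open>\<rho> ^ k\<close>. For a nonbasic class the entries stay bounded. Cutting walks at
  the edge by which they leave an access class, one finds that \<open>H s x y\<close> has exact order
  \<open>(1 / (1 - \<rho> s)) ^ p\<close>, where \<open>p\<close> is the maximal length of a chain of basic classes from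
  \<open>x\<close> to \<open>y\<close>. By Cramer's rule the entries of \<open>H\<close> are rational functions of \<open>s\<close>, so boundedness of
  \<open>(1 - \<rho> s) ^ h * H s x y\<close> gives convergence.
\<close>

section \<open>Weights of walks of given length\<close>

text \<open>These are the entries of the powers of \<open>adj_mat S w\<close>, indexed by vertices
  instead of numbers. The set \<open>S\<close> is a parameter because walks in \<open>V\<close> are
  compared with walks that stay inside one access class.\<close>

fun walk_weight :: "'v set \<Rightarrow> ('v \<Rightarrow> 'v \<Rightarrow> real) \<Rightarrow> nat \<Rightarrow> 'v \<Rightarrow> 'v \<Rightarrow> real" where
  "walk_weight S w 0 x y = (if x = y then 1 else 0)"
| "walk_weight S w (Suc k) x y = (\<Sum>a\<in>S. walk_weight S w k x a * w a y)"

lemma walk_weight_nonneg: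
  assumes "\<And>x y. x \<in> S \<Longrightarrow> y \<in> S \<Longrightarrow> 0 \<le> w x y" "x \<in> S" "y \<in> S"
  shows "0 \<le> walk_weight S w k x y"
  using assms(3)
proof (induction k arbitrary: y)
  case (Suc k)
  then show ?case using assms(1) by (auto intro!: sum_nonneg mult_nonneg_nonneg)
qed simp

lemma walk_weight_add:
  assumes "finite S" "y \<in> S"
  shows "walk_weight S w (k + l) x y = (\<Sum>a\<in>S. walk_weight S w k x a * walk_weight S w l a y)"
  using assms(2)
proof (induction l arbitrary: y)
  case 0
  have "(\<Sum>a\<in>S. walk_weight S w k x a * walk_weight S w 0 a y)
      = (\<Sum>a\<in>S. if a = y then walk_weight S w k x a else 0)"
    by (intro sum.cong) auto
  then show ?case using 0 assms(1) by simp
next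
  case (Suc l)
  have "walk_weight S w (k + Suc l) x y
      = (\<Sum>b\<in>S. \<Sum>a\<in>S. walk_weight S w k x a * walk_weight S w l a b * w b y)"
    using Suc by (simp add: sum_distrib_right)
  also have "\<dots> = (\<Sum>a\<in>S. \<Sum>b\<in>S. walk_weight S w k x a * walk_weight S w l a b * w b y)"
    by (rule sum.swap)
  finally show ?case by (simp add: sum_distrib_left mult.assoc)
qed

lemma walk_weight_1:
  assumes "finite S" "x \<in> S" "y \<in> S"
  shows "walk_weight S w 1 x y = w x y"
proof -
  have "walk_weight S w 1 x y = (\<Sum>a\<in>S. if x = a then w a y else 0)"
    by (auto intro!: sum.cong)
  then show ?thesis using assms by simp
qed

lemma walk_weight_Suc_left:
  assumes "finite S" "x \<in> S" "y \<in> S"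
  shows "walk_weight S w (Suc k) x y = (\<Sum>a\<in>S. w x a * walk_weight S w k a y)"
proof -
  have "walk_weight S w (1 + k) x y = (\<Sum>a\<in>S. w x a * walk_weight S w k a y)"
    unfolding walk_weight_add[OF assms(1,3)]
    by (intro sum.cong refl) (simp only: walk_weight_1[OF assms(1,2)])
  then show ?thesis by simp
qed

lemma walk_weight_mono:
  assumes "finite V" "S \<subseteq> V" "\<And>x y. x \<in> V \<Longrightarrow> y \<in> V \<Longrightarrow> 0 \<le> w x y" "x \<in> S" "y \<in> S"
  shows "walk_weight S w k x y \<le> walk_weight V w k x y"
  using assms(5)
proof (induction k arbitrary: y)
  case (Suc k)
  have "walk_weight S w (Suc k) x y \<le> (\<Sum>a\<in>S. walk_weight V w k x a * w a y)"
    using Suc assms(2,3) by (auto intro!: sum_mono mult_right_mono assms(3))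
  also have "\<dots> \<le> (\<Sum>a\<in>V. walk_weight V w k x a * w a y)"
    using Suc assms
    by (intro sum_mono2) (auto intro!: mult_nonneg_nonneg walk_weight_nonneg)
  finally show ?case by simp
qed simp

text \<open>Supermultiplicativity of closed walks: in the expansion by
  \<open>walk_weight_add\<close> only the walks that are back at \<open>x\<close> after
  \<open>k\<close> steps are kept, and the dropped terms are nonnegative.\<close>

lemma walk_weight_power_le:
  assumes "finite S" "\<And>x y. x \<in> S \<Longrightarrow> y \<in> S \<Longrightarrow> 0 \<le> w x y" "x \<in> S"
  shows "walk_weight S w k x x ^ j \<le> walk_weight S w (j * k) x x"
proof (induction j)
  case (Suc j)
  note nn = walk_weight_nonneg[of S w, OF assms(2)]
  have "walk_weight S w k x x ^ Suc j \<le> walk_weight S w k x x * walk_weight S w (j * k) x x"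
    using Suc assms(3) nn by (simp add: mult_left_mono)
  also have "\<dots> \<le> (\<Sum>a\<in>S. walk_weight S w k x a * walk_weight S w (j * k) a x)"
    using assms nn
    by (intro member_le_sum[where f = "\<lambda>a. walk_weight S w k x a * walk_weight S w (j * k) a x"])
      (auto intro!: mult_nonneg_nonneg)
  also have "\<dots> = walk_weight S w (Suc j * k) x x"
    using walk_weight_add[of S x w k "j * k" x] assms by simp
  finally show ?case .
qed simp

section \<open>Walk weights as matrix powers, and the spectral radius\<close>

lemma adj_mat_carrier [simp]: "adj_mat S w \<in> carrier_mat (card S) (card S)"
  by (simp add: adj_mat_def)

lemma adj_mat_dim [simp]: "dim_row (adj_mat S w) = card S" "dim_col (adj_mat S w) = card S"
  by (simp_all add: adj_mat_def)

lemma sum_from_nat_into: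
  assumes "finite S"
  shows "(\<Sum>i\<in>{0..<card S}. f (from_nat_into S i)) = (\<Sum>a\<in>S. f a)"
  using sum.reindex_bij_betw[OF bij_betw_from_nat_into_finite[OF assms], of f]
  by (simp add: atLeast0LessThan)

lemma adj_mat_pow:
  assumes "finite S" "i < card S" "j < card S"
  shows "(adj_mat S w ^\<^sub>m k) $$ (i, j) = walk_weight S w k (from_nat_into S i) (from_nat_into S j)"
  using assms(3)
proof (induction k arbitrary: j)
  case 0
  have "from_nat_into S i = from_nat_into S j \<longleftrightarrow> i = j"
    using bij_betw_from_nat_into_finite[OF assms(1)] assms(2) 0
    by (auto simp: bij_betw_def inj_on_def)
  then show ?case using assms 0 by simp
next
  case (Suc k)
  have "(adj_mat S w ^\<^sub>m Suc k) $$ (i, j)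
     = (\<Sum>l\<in>{0..<card S}. (adj_mat S w ^\<^sub>m k) $$ (i, l) * adj_mat S w $$ (l, j))"
    using assms Suc.prems by (simp add: scalar_prod_def)
  also have "\<dots> = (\<Sum>l\<in>{0..<card S}. walk_weight S w k (from_nat_into S i) (from_nat_into S l)
        * w (from_nat_into S l) (from_nat_into S j))"
    using Suc by (intro sum.cong) (auto simp: adj_mat_def)
  also have "\<dots> = walk_weight S w (Suc k) (from_nat_into S i) (from_nat_into S j)"
    using sum_from_nat_into[OF assms(1), of "\<lambda>a. walk_weight S w k (from_nat_into S i) a
        * w a (from_nat_into S j)"] by simp
  finally show ?case .
qed

lemma to_nat_on_less:
  assumes "finite S" "x \<in> S"
  shows "to_nat_on S x < card S"
  using to_nat_on_finite[OF assms(1)] assms(2) by (auto simp: bij_betw_def)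

lemma smult_pow_mat:
  fixes c :: "'a :: comm_ring_1"
  assumes "A \<in> carrier_mat n n"
  shows "(c \<cdot>\<^sub>m A) ^\<^sub>m k = c ^ k \<cdot>\<^sub>m A ^\<^sub>m k"
proof (induction k)
  case (Suc k)
  have Ak: "A ^\<^sub>m k \<in> carrier_mat n n"
    using assms by simp
  have "(c \<cdot>\<^sub>m A) ^\<^sub>m Suc k = (c ^ k \<cdot>\<^sub>m A ^\<^sub>m k) * (c \<cdot>\<^sub>m A)"
    using Suc by simp
  also have "\<dots> = c ^ k \<cdot>\<^sub>m (c \<cdot>\<^sub>m (A ^\<^sub>m k * A))"
    by (subst mult_smult_assoc_mat[of _ n n _ n], use Ak assms in simp_all)
      (subst mult_smult_distrib[of _ n n _ n], use Ak assms in simp_all)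
  also have "\<dots> = c ^ Suc k \<cdot>\<^sub>m A ^\<^sub>m Suc k"
    using Ak assms by (intro eq_matI) (auto simp: mult_ac)
  finally show ?case .
qed (use assms in auto)

text \<open>An eigenvector of the scaled matrix for \<open>e\<close> is an eigenvector of
  \<open>A\<close> for \<open>e / t\<close>, so \<open>norm e / t\<close> is at most the spectral
  radius of \<open>A\<close>.\<close>

lemma spectral_radius_smult_less_1:
  assumes A: "A \<in> carrier_mat n n" and n: "0 < n" and t: "0 < t" and r: "spectral_radius A * t < 1"
  shows "spectral_radius (complex_of_real t \<cdot>\<^sub>m A) < 1"
proof -
  let ?B = "complex_of_real t \<cdot>\<^sub>m A"
  have B: "?B \<in> carrier_mat n n" using A by simp
  obtain e where e: "e \<in> spectrum ?B" "norm e = spectral_radius ?B"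
    using spectral_radius_mem_max(1)[OF B n] by auto
  then obtain v where v: "eigenvector ?B v e"
    by (auto simp: spectrum_def eigenvalue_def)
  then have v': "v \<in> carrier_vec n" "v \<noteq> 0\<^sub>v n" "?B *\<^sub>v v = e \<cdot>\<^sub>v v"
    using A by (auto simp: eigenvector_def)
  have "complex_of_real t \<cdot>\<^sub>v (A *\<^sub>v v) = e \<cdot>\<^sub>v v"
    using v' A by (auto simp: vec_eq_iff scalar_prod_def sum_distrib_left mult.assoc)
  then have "A *\<^sub>v v = (e / complex_of_real t) \<cdot>\<^sub>v v"
    using v' A t by (auto simp: vec_eq_iff field_simps)
  then have "eigenvector A v (e / complex_of_real t)"
    using v' A by (auto simp: eigenvector_def)
  then have "norm (e / complex_of_real t) \<in> norm ` spectrum A"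
    by (intro imageI) (auto simp: spectrum_def eigenvalue_def)
  then have "norm (e / complex_of_real t) \<le> spectral_radius A"
    using spectral_radius_mem_max(2)[OF A n] by blast
  then have "norm e \<le> spectral_radius A * t"
    using t by (simp add: norm_divide field_simps)
  then show ?thesis using e r by simp
qed

lemma map_mat_pow:
  assumes "A \<in> carrier_mat n n"
  shows "map_mat complex_of_real A ^\<^sub>m k = map_mat complex_of_real (A ^\<^sub>m k)"
proof (induction k)
  case (Suc k)
  have "A ^\<^sub>m k \<in> carrier_mat n n" using assms by simp
  then show ?case using Suc assms
    by (simp add: of_real_hom.mat_hom_mult[of _ n n _ n])
qed (use assms in \<open>auto simp: of_real_hom.mat_hom_one\<close>)

text \<open>The bound on \<open>t\<close> is an open condition, so it still holds at some
  \<open>u > t\<close>. The matrix scaled by \<open>u\<close> has spectral radius below 1, hence its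
  powers are bounded entrywise by one constant \<open>c\<close>, and the series is dominated by a
  geometric series of ratio \<open>t / u\<close>.\<close>

lemma walk_weight_summable:
  assumes S: "finite S" and nn: "\<And>x y. x \<in> S \<Longrightarrow> y \<in> S \<Longrightarrow> 0 \<le> w x y"
    and t: "0 \<le> t" "graph_radius S w * t < 1" and xy: "x \<in> S" "y \<in> S"
  shows "summable (\<lambda>k. walk_weight S w k x y * t ^ k)"
proof -
  have ne: "S \<noteq> {}" using xy by auto
  let ?A = "map_mat complex_of_real (adj_mat S w)"
  have r: "graph_radius S w = spectral_radius ?A"
    using ne by (simp add: graph_radius_def)
  have A: "?A \<in> carrier_mat (card S) (card S)" by simp
  have n: "0 < card S" using S ne by (simp add: card_gt_0_iff)
  have "((\<lambda>u. spectral_radius ?A * u) \<longlongrightarrow> spectral_radius ?A * t) (at_right t)"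
    by (intro tendsto_intros)
  then have "eventually (\<lambda>u. spectral_radius ?A * u < 1) (at_right t)"
    using t r by (auto dest: order_tendstoD)
  then obtain b where b: "b > t" "\<And>u. t < u \<Longrightarrow> u < b \<Longrightarrow> spectral_radius ?A * u < 1"
    by (auto simp: eventually_at_right[of t "t + 1"])
  define u where "u = (t + b) / 2"
  have u: "t < u" "u < b" using b(1) by (auto simp: u_def)
  note u = u(1) b(2)[OF u]
  have u0: "0 < u" using u t by simp
  from spectral_radius_smult_less_1[OF A n u0 u(2)] A
  obtain c where c: "\<And>k. norm_bound ((complex_of_real u \<cdot>\<^sub>m ?A) ^\<^sub>m k) c"
    using spectral_radius_jnf_norm_bound_less_1_upper_triangular[of "complex_of_real u \<cdot>\<^sub>m ?A" "card S"]
    by auto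
  let ?i = "to_nat_on S x" and ?j = "to_nat_on S y"
  have ij: "?i < card S" "?j < card S" using S xy by (auto intro: to_nat_on_less)
  have bound: "u ^ k * walk_weight S w k x y \<le> c" for k
  proof -
    have "((complex_of_real u \<cdot>\<^sub>m ?A) ^\<^sub>m k) $$ (?i, ?j)
        = complex_of_real (u ^ k * walk_weight S w k x y)"
      unfolding smult_pow_mat[OF A] map_mat_pow[OF adj_mat_carrier]
      using ij adj_mat_pow[OF S ij] S xy by (simp add: countable_finite)
    moreover have "norm (((complex_of_real u \<cdot>\<^sub>m ?A) ^\<^sub>m k) $$ (?i, ?j)) \<le> c"
      using c[of k] ij unfolding norm_bound_def by simp
    ultimately show ?thesis by (metis norm_of_real abs_ge_self order_trans)
  qed
  have "summable (\<lambda>k. c * (t / u) ^ k)"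
    using t u u0 by (intro summable_mult summable_geometric) simp
  then show ?thesis
  proof (rule summable_comparison_test'[where N = 0])
    fix k
    have "walk_weight S w k x y * t ^ k = (u ^ k * walk_weight S w k x y) * (t / u) ^ k"
      using u0 by (simp add: power_divide)
    also have "\<dots> \<le> c * (t / u) ^ k"
      using bound[of k] t u0 by (intro mult_right_mono) auto
    finally show "norm (walk_weight S w k x y * t ^ k) \<le> c * (t / u) ^ k"
      using walk_weight_nonneg[of S w x y k] nn xy t by simp
  qed
qed

text \<open>Let \<open>v\<close> be an eigenvector for an eigenvalue of maximal modulus and let
  \<open>x\<close> be the index of a coordinate of \<open>v\<close> of maximal modulus
  \<open>M\<close>. The triangle inequality in that coordinate of the \<open>k\<close>-th power
  applied to \<open>v\<close> gives the bound after division by \<open>M\<close>. The choice of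
  \<open>x\<close> depends on \<open>v\<close> only, so one row serves all \<open>k\<close>.\<close>

lemma walk_weight_row_ge_graph_radius:
  assumes S: "finite S" "S \<noteq> {}" and nn: "\<And>x y. x \<in> S \<Longrightarrow> y \<in> S \<Longrightarrow> 0 \<le> w x y"
  shows "\<exists>x\<in>S. \<forall>k. graph_radius S w ^ k \<le> (\<Sum>y\<in>S. walk_weight S w k x y)"
proof -
  let ?A = "map_mat complex_of_real (adj_mat S w)"
  let ?n = "card S"
  have A: "?A \<in> carrier_mat ?n ?n" by simp
  have n: "0 < ?n" using S by (simp add: card_gt_0_iff)
  obtain e where e: "e \<in> spectrum ?A" "norm e = graph_radius S w"
    using spectral_radius_mem_max(1)[OF A n] S unfolding graph_radius_def
    by (metis imageE)
  then obtain v where v: "eigenvector ?A v e"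
    by (auto simp: spectrum_def eigenvalue_def)
  then have v': "v \<in> carrier_vec ?n" "v \<noteq> 0\<^sub>v ?n"
    by (auto simp: eigenvector_def)
  define M where "M = Max ((\<lambda>i. norm (v $ i)) ` {..<?n})"
  have "M \<in> (\<lambda>i. norm (v $ i)) ` {..<?n}"
    unfolding M_def using n by (intro Max_in) auto
  then obtain i where i: "i < ?n" "norm (v $ i) = M" by auto
  have le: "norm (v $ j) \<le> M" if "j < ?n" for j
    unfolding M_def using that by (intro Max_ge) auto
  have "M \<noteq> 0"
  proof
    assume "M = 0"
    then have "v = 0\<^sub>v ?n" using le v' by (intro eq_vecI) auto
    then show False using v' by simp
  qed
  then have M: "0 < M" using i by (metis norm_ge_zero less_eq_real_def)
  have "graph_radius S w ^ k \<le> (\<Sum>y\<in>S. walk_weight S w k (from_nat_into S i) y)" for k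
  proof -
    have nnw: "0 \<le> walk_weight S w k (from_nat_into S i) (from_nat_into S j)" for j
      using S nn by (intro walk_weight_nonneg) (auto intro: from_nat_into)
    have "(?A ^\<^sub>m k *\<^sub>v v) $ i = e ^ k * v $ i"
      unfolding eigenvector_pow[OF A v] using i v' by simp
    moreover have "(?A ^\<^sub>m k *\<^sub>v v) $ i = (\<Sum>j\<in>{0..<?n}.
        complex_of_real (walk_weight S w k (from_nat_into S i) (from_nat_into S j)) * v $ j)"
      unfolding map_mat_pow[OF adj_mat_carrier]
      using i v' S(1) by (simp add: scalar_prod_def adj_mat_pow)
    ultimately have "norm e ^ k * M = norm (\<Sum>j\<in>{0..<?n}.
        complex_of_real (walk_weight S w k (from_nat_into S i) (from_nat_into S j)) * v $ j)"
      using i by (metis norm_mult norm_power)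
    also have "\<dots> \<le> (\<Sum>j\<in>{0..<?n}. walk_weight S w k (from_nat_into S i) (from_nat_into S j) * M)"
      by (intro sum_norm_le) (auto simp: norm_mult nnw intro!: mult_left_mono le)
    also have "\<dots> = (\<Sum>y\<in>S. walk_weight S w k (from_nat_into S i) y) * M"
      using sum_from_nat_into[OF S(1), of "\<lambda>y. walk_weight S w k (from_nat_into S i) y"]
      by (simp add: sum_distrib_right[symmetric])
    finally show ?thesis using M e by simp
  qed
  then show ?thesis using from_nat_into[OF S(2)] by blast
qed

section \<open>Access and access classes\<close>

lemma has_access_refl: "x \<in> V \<Longrightarrow> has_access V w x x"
  by (simp add: has_access_def)

lemma has_access_trans: "has_access V w x y \<Longrightarrow> has_access V w y z \<Longrightarrow> has_access V w x z"
  by (auto simp: has_access_def)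

lemma has_access_edge: "x \<in> V \<Longrightarrow> y \<in> V \<Longrightarrow> 0 < w x y \<Longrightarrow> has_access V w x y"
  by (auto simp: has_access_def edges_def)

lemma access_equiv: "equiv V {(x, y). has_access V w x y \<and> has_access V w y x}"
  by (rule equivI) (auto simp: refl_on_def sym_def trans_def has_access_refl
      intro: has_access_trans simp: has_access_def)

lemma access_class_iff:
  assumes "C \<in> access_classes V w" "x \<in> C"
  shows "y \<in> C \<longleftrightarrow> has_access V w x y \<and> has_access V w y x"
proof -
  obtain z where z: "z \<in> V" "C = {y. has_access V w z y \<and> has_access V w y z}"
    using assms(1) by (auto simp: access_classes_def quotient_def)
  show ?thesis
    using assms(2) unfolding z(2) mem_Collect_eq by (meson has_access_trans)
qed

lemma access_class_subset: "C \<in> access_classes V w \<Longrightarrow> C \<subseteq> V"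
  using access_class_iff[of C V w] by (auto simp: has_access_def)

lemma access_class_nonempty: "C \<in> access_classes V w \<Longrightarrow> C \<noteq> {}"
  unfolding access_classes_def using in_quotient_imp_non_empty[OF access_equiv] by blast

lemma access_class_exists:
  assumes "x \<in> V"
  shows "\<exists>C\<in>access_classes V w. x \<in> C"
  using assms quotientI[of x V "{(x, y). has_access V w x y \<and> has_access V w y x}"]
    equiv_class_self[OF access_equiv assms]
  unfolding access_classes_def by blast

lemma access_class_eqI:
  assumes "C \<in> access_classes V w" "D \<in> access_classes V w" "x \<in> C" "x \<in> D"
  shows "C = D"
  using access_class_iff[OF assms(1,3)] access_class_iff[OF assms(2,4)] by auto

section \<open>The growth matrix to the left of \<open>1 / \<rho>\<close>\<close>

locale growth =
  fixes V :: "'v set" and w :: "'v \<Rightarrow> 'v \<Rightarrow> real"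
  assumes digraph: "weighted_digraph V w"
    and radius_pos: "0 < graph_radius V w"
begin

abbreviation \<rho> :: real where "\<rho> \<equiv> graph_radius V w"

text \<open>The filter of the limits in \<open>is_residual\<close>; all orders of magnitude are
  expressed by Landau symbols along it.\<close>

definition near :: "real filter" where
  "near = at (1 / \<rho>) within {0<..<1 / \<rho>}"

text \<open>The growth matrix indexed by vertices, linked to \<open>growth_mat\<close> by
  \<open>growth_mat_entry\<close>.\<close>

definition H :: "real \<Rightarrow> 'v \<Rightarrow> 'v \<Rightarrow> real" where
  "H s x y = (\<Sum>k. walk_weight V w k x y * s ^ k)"

lemma finite_V: "finite V" and w_nonneg: "x \<in> V \<Longrightarrow> y \<in> V \<Longrightarrow> 0 \<le> w x y"
  using digraph by (auto simp: weighted_digraph_def)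

lemma walk_nonneg: "x \<in> V \<Longrightarrow> y \<in> V \<Longrightarrow> 0 \<le> walk_weight V w k x y"
  using w_nonneg by (rule walk_weight_nonneg)

lemma near_at_left: "near = at_left (1 / \<rho>)"
  unfolding near_def using radius_pos
  by (intro at_within_nhd[of _ "{0<..}"]) auto

lemma near_nontrivial: "near \<noteq> bot"
  by (simp add: near_at_left trivial_limit_at_left_real)

text \<open>The value \<open>1 / (2 * \<rho>)\<close> is an arbitrary positive bound below
  \<open>1 / \<rho>\<close>. It keeps \<open>s\<close> away from 0, so that the factors
  \<open>s\<close> in the recursions for \<open>H\<close> can be absorbed into constants.\<close>

lemma eventually_near: "eventually (\<lambda>s. 1 / (2 * \<rho>) < s \<and> s < 1 / \<rho>) near"
proof -
  have "1 / (2 * \<rho>) < 1 / \<rho>" using radius_pos by (simp add: field_simps)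
  then show ?thesis unfolding near_at_left
    using eventually_at_left_real[of "1 / (2 * \<rho>)" "1 / \<rho>"] by (simp add: greaterThanLessThan_iff)
qed

lemma nearI:
  assumes "\<And>s. 1 / (2 * \<rho>) < s \<Longrightarrow> 0 < s \<Longrightarrow> s < 1 / \<rho> \<Longrightarrow> 0 < 1 - \<rho> * s \<Longrightarrow> P s"
  shows "eventually P near"
  using eventually_near
proof (rule eventually_mono)
  fix s assume s: "1 / (2 * \<rho>) < s \<and> s < 1 / \<rho>"
  moreover have "0 < 1 / (2 * \<rho>)" using radius_pos by simp
  moreover have "0 < 1 - \<rho> * s" using s radius_pos by (simp add: field_simps)
  ultimately show "P s" by (intro assms) linarith+
qed

lemma bigo_nearI:
  fixes f g :: "real \<Rightarrow> real"
  assumes "\<And>s. 1 / (2 * \<rho>) < s \<Longrightarrow> 0 < s \<Longrightarrow> s < 1 / \<rho> \<Longrightarrow> 0 < 1 - \<rho> * s \<Longrightarrow>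
    \<bar>f s\<bar> \<le> c * \<bar>g s\<bar>"
  shows "f \<in> O[near](g)"
  by (rule bigoI[of _ c]) (use assms in \<open>auto intro!: nearI\<close>)

lemma H_summable:
  assumes "0 \<le> s" "s < 1 / \<rho>" "x \<in> V" "y \<in> V"
  shows "summable (\<lambda>k. walk_weight V w k x y * s ^ k)"
  using assms radius_pos w_nonneg
  by (intro walk_weight_summable finite_V) (auto simp: field_simps)

lemma H_nonneg:
  assumes "0 \<le> s" "s < 1 / \<rho>" "x \<in> V" "y \<in> V"
  shows "0 \<le> H s x y"
  unfolding H_def using assms walk_nonneg by (intro suminf_nonneg H_summable) auto

text \<open>The resolvent identity H = I + s F H: a walk is either empty or splits into its first
  edge and a shorter walk.\<close>

lemma H_left:
  assumes s: "0 \<le> s" "s < 1 / \<rho>" and xy: "x \<in> V" "y \<in> V"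
  shows "H s x y = (if x = y then 1 else 0) + s * (\<Sum>a\<in>V. w x a * H s a y)"
proof -
  have "H s x y = (if x = y then 1 else 0) + (\<Sum>k. walk_weight V w (Suc k) x y * s ^ Suc k)"
    unfolding H_def using suminf_split_head[OF H_summable[OF s xy]] by simp
  also have "(\<lambda>k. walk_weight V w (Suc k) x y * s ^ Suc k)
      = (\<lambda>k. \<Sum>a\<in>V. (s * w x a) * (walk_weight V w k a y * s ^ k))"
    unfolding walk_weight_Suc_left[OF finite_V xy] by (simp add: sum_distrib_left sum_distrib_right mult_ac)
  also have "suminf \<dots> = (\<Sum>a\<in>V. \<Sum>k. (s * w x a) * (walk_weight V w k a y * s ^ k))"
    using s xy by (intro suminf_sum summable_mult H_summable) auto
  also have "\<dots> = (\<Sum>a\<in>V. (s * w x a) * H s a y)"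
    unfolding H_def using s xy by (intro sum.cong refl suminf_mult H_summable) auto
  finally show ?thesis by (simp add: sum_distrib_left mult.assoc)
qed

text \<open>The mirror identity H = I + s H F, obtained by splitting off the last edge.\<close>

lemma H_right:
  assumes s: "0 \<le> s" "s < 1 / \<rho>" and xy: "x \<in> V" "y \<in> V"
  shows "H s x y = (if x = y then 1 else 0) + s * (\<Sum>a\<in>V. H s x a * w a y)"
proof -
  have "H s x y = (if x = y then 1 else 0) + (\<Sum>k. walk_weight V w (Suc k) x y * s ^ Suc k)"
    unfolding H_def using suminf_split_head[OF H_summable[OF s xy]] by simp
  also have "(\<lambda>k. walk_weight V w (Suc k) x y * s ^ Suc k)
      = (\<lambda>k. \<Sum>a\<in>V. (s * w a y) * (walk_weight V w k x a * s ^ k))"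
    by (simp add: sum_distrib_left sum_distrib_right mult_ac)
  also have "suminf \<dots> = (\<Sum>a\<in>V. \<Sum>k. (s * w a y) * (walk_weight V w k x a * s ^ k))"
    using s xy by (intro suminf_sum summable_mult H_summable) auto
  also have "\<dots> = (\<Sum>a\<in>V. (s * w a y) * H s x a)"
    unfolding H_def using s xy by (intro sum.cong refl suminf_mult H_summable) auto
  finally show ?thesis by (simp add: sum_distrib_left mult_ac)
qed

lemma walk_weight_eq_0:
  assumes "x \<in> V" "y \<in> V" "\<not> has_access V w x y"
  shows "walk_weight V w k x y = 0"
  using assms(2,3)
proof (induction k arbitrary: y)
  case 0
  then show ?case using has_access_refl[OF assms(1)] by auto
next
  case (Suc k)
  have "walk_weight V w k x a * w a y = 0" if "a \<in> V" for a
  proof (cases "w a y = 0")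
    case False
    then have "has_access V w a y"
      using w_nonneg[OF that Suc.prems(1)] that Suc.prems by (intro has_access_edge) auto
    then have "\<not> has_access V w x a" using Suc.prems has_access_trans by metis
    then show ?thesis using Suc.IH that by simp
  qed simp
  then show ?case by simp
qed

lemma H_eq_0: "x \<in> V \<Longrightarrow> y \<in> V \<Longrightarrow> \<not> has_access V w x y \<Longrightarrow> H s x y = 0"
  by (simp add: H_def walk_weight_eq_0)

section \<open>Entries within one access class, and the exit from the class\<close>

text \<open>For a single edge from \<open>x\<close> to \<open>a\<close>, keeping only the term of
  \<open>a\<close> in \<open>H_left\<close> bounds \<open>H s x y\<close> from below by
  \<open>s * w x a * H s a y\<close>, and \<open>s\<close> is bounded below near
  \<open>1 / \<rho>\<close>. A path is treated by chaining its edges. Together with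
  \<open>H_harnack_right\<close> this makes all entries with both indices in one class
  comparable.\<close>

lemma H_harnack_left:
  assumes "has_access V w x z" "y \<in> V"
  shows "(\<lambda>s. H s z y) \<in> O[near](\<lambda>s. H s x y)"
proof -
  have "(x, z) \<in> (edges V w)\<^sup>*" using assms(1) by (simp add: has_access_def)
  then show ?thesis
  proof (induction rule: converse_rtrancl_induct)
    case (step x a)
    have xa: "x \<in> V" "a \<in> V" "0 < w x a" using step(1) by (auto simp: edges_def)
    have "(\<lambda>s. H s a y) \<in> O[near](\<lambda>s. H s x y)"
    proof (rule bigo_nearI)
      fix s assume s: "1 / (2 * \<rho>) < s" "0 < s" "s < 1 / \<rho>"
      have nn: "0 \<le> w x b * H s b y" if "b \<in> V" for b
        using that xa s assms w_nonneg H_nonneg by auto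
      have "1 / (2 * \<rho>) * (w x a * H s a y) \<le> s * (w x a * H s a y)"
        using s nn xa by (intro mult_right_mono) auto
      also have "\<dots> \<le> s * (\<Sum>b\<in>V. w x b * H s b y)"
        using s nn xa finite_V
        by (intro mult_left_mono member_le_sum[where f = "\<lambda>b. w x b * H s b y"]) auto
      also have "\<dots> \<le> H s x y" using H_left[of s x y] s xa assms by auto
      finally have "H s a y \<le> (2 * \<rho> / w x a) * H s x y"
        using xa radius_pos by (simp add: field_simps)
      then show "\<bar>H s a y\<bar> \<le> (2 * \<rho> / w x a) * \<bar>H s x y\<bar>"
        using s xa assms H_nonneg by simp
    qed
    then show ?case using step.IH landau_o.big_trans by blast
  qed simp
qed

lemma H_harnack_right:
  assumes "has_access V w z y" "x \<in> V"
  shows "(\<lambda>s. H s x z) \<in> O[near](\<lambda>s. H s x y)"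
proof -
  have "(z, y) \<in> (edges V w)\<^sup>*" using assms(1) by (simp add: has_access_def)
  then show ?thesis
  proof (induction rule: rtrancl_induct)
    case (step a y)
    have ya: "y \<in> V" "a \<in> V" "0 < w a y" using step(2) by (auto simp: edges_def)
    have "(\<lambda>s. H s x a) \<in> O[near](\<lambda>s. H s x y)"
    proof (rule bigo_nearI)
      fix s assume s: "1 / (2 * \<rho>) < s" "0 < s" "s < 1 / \<rho>"
      have nn: "0 \<le> H s x b * w b y" if "b \<in> V" for b
        using that ya s assms w_nonneg H_nonneg by auto
      have "1 / (2 * \<rho>) * (H s x a * w a y) \<le> s * (H s x a * w a y)"
        using s nn ya by (intro mult_right_mono) auto
      also have "\<dots> \<le> s * (\<Sum>b\<in>V. H s x b * w b y)"
        using s nn ya finite_V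
        by (intro mult_left_mono member_le_sum[where f = "\<lambda>b. H s x b * w b y"]) auto
      also have "\<dots> \<le> H s x y" using H_right[of s x y] s ya assms by auto
      finally have "H s x a \<le> (2 * \<rho> / w a y) * H s x y"
        using ya radius_pos by (simp add: field_simps)
      then show "\<bar>H s x a\<bar> \<le> (2 * \<rho> / w a y) * \<bar>H s x y\<bar>"
        using s ya assms H_nonneg by simp
    qed
    then show ?case using step.IH landau_o.big_trans by blast
  qed simp
qed

text \<open>Otherwise the diagonal entry of the growth matrix would diverge at some \<open>s < 1 / \<rho>\<close>.\<close>

lemma walk_weight_diag_le:
  assumes x: "x \<in> V"
  shows "walk_weight V w k x x \<le> \<rho> ^ k"
proof (cases "k = 0")
  case False
  then have k: "0 < k" by simp
  show ?thesis
  proof (rule ccontr)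
    assume "\<not> ?thesis"
    then have gt: "\<rho> ^ k < walk_weight V w k x x" by simp
    \<comment> \<open>Divergence is exhibited at \<open>1 / r\<close>, which is less than
      \<open>1 / \<rho>\<close>: along the multiples of \<open>k\<close> the terms of the series
      there are at least 1.\<close>
    define r where "r = root k (walk_weight V w k x x)"
    have rk: "r ^ k = walk_weight V w k x x"
      using walk_nonneg[OF x x] k by (simp add: r_def)
    have "0 \<le> r" using walk_nonneg[OF x x] k by (simp add: r_def)
    then have r: "\<rho> < r" using gt rk by (metis power_less_imp_less_base)
    then have r0: "0 < r" using radius_pos by simp
    have "1 \<le> walk_weight V w (j * k) x x * (1 / r) ^ (j * k)" for j
    proof -
      have "r ^ (j * k) \<le> walk_weight V w (j * k) x x"
        using walk_weight_power_le[where w = w and k = k and j = j, OF finite_V w_nonneg x]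
        unfolding rk[symmetric] by (simp only: power_mult[symmetric] mult.commute[of k j])
      then show ?thesis using r0 by (simp add: power_one_over field_simps)
    qed
    moreover have "(\<lambda>k. walk_weight V w k x x * (1 / r) ^ k) \<longlonglongrightarrow> 0"
      using r r0 radius_pos x
      by (intro summable_LIMSEQ_zero H_summable) (auto simp: field_simps)
    then have "(\<lambda>j. walk_weight V w (j * k) x x * (1 / r) ^ (j * k)) \<longlonglongrightarrow> 0"
      using LIMSEQ_subseq_LIMSEQ[of "\<lambda>k. walk_weight V w k x x * (1 / r) ^ k" 0 "\<lambda>j. j * k"] k
      by (simp add: strict_mono_def o_def)
    ultimately have "(1 :: real) \<le> 0" by (intro LIMSEQ_le_const) auto
    then show False by simp
  qed
qed simp

lemma H_diag_le:
  assumes "0 \<le> s" "s < 1 / \<rho>" "x \<in> V"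
  shows "H s x x \<le> 1 / (1 - \<rho> * s)"
proof -
  have *: "norm (\<rho> * s) < 1" using assms radius_pos by (simp add: field_simps)
  have "H s x x \<le> (\<Sum>k. (\<rho> * s) ^ k)"
    unfolding H_def using assms walk_weight_diag_le *
    by (intro suminf_le H_summable summable_geometric) (auto simp: power_mult_distrib intro!: mult_right_mono)
  then show ?thesis using suminf_geometric[OF *] by simp
qed

text \<open>Every vertex on a walk between two vertices of a class is accessible from the first and
  has access to the second, so it belongs to the class.\<close>

lemma walk_weight_class:
  assumes "C \<in> access_classes V w" "x \<in> C" "y \<in> C"
  shows "walk_weight C w k x y = walk_weight V w k x y"
  using assms(3)
proof (induction k arbitrary: y)
  case (Suc k)
  have "walk_weight V w k x a * w a y = 0" if a: "a \<in> V - C" for a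
  proof (rule ccontr)
    assume nz: "walk_weight V w k x a * w a y \<noteq> 0"
    have V: "x \<in> V" "y \<in> V" using access_class_subset assms Suc by auto
    have "has_access V w x a" using walk_weight_eq_0 nz V a by force
    moreover have "has_access V w a y"
      using w_nonneg[of a y] nz V a by (intro has_access_edge) auto
    moreover have "has_access V w y x" using access_class_iff assms Suc.prems by metis
    ultimately have "a \<in> C" using access_class_iff[OF assms(1,2)] has_access_trans by metis
    then show False using a by simp
  qed
  then have "walk_weight V w (Suc k) x y = (\<Sum>a\<in>C. walk_weight V w k x a * w a y)"
    using access_class_subset[OF assms(1)] finite_V
    by (simp, intro sum.mono_neutral_right) auto
  then show ?case using Suc by simp
qed simp

text \<open>Otherwise \<open>1 / graph_radius C w\<close> would be a point below
  \<open>1 / \<rho>\<close>, where the terms of the convergent series for \<open>H\<close> tend to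
  0. But the row of \<open>C\<close> given by \<open>walk_weight_row_ge_graph_radius\<close> keeps
  the sum of these terms at 1 or more.\<close>

lemma class_radius_le:
  assumes C: "C \<in> access_classes V w"
  shows "graph_radius C w \<le> \<rho>"
proof (rule ccontr)
  assume "\<not> ?thesis"
  then have r: "\<rho> < graph_radius C w" "0 < graph_radius C w" using radius_pos by auto
  note sub = access_class_subset[OF C]
  obtain x where x: "x \<in> C" "\<And>k. graph_radius C w ^ k \<le> (\<Sum>y\<in>C. walk_weight C w k x y)"
    using walk_weight_row_ge_graph_radius[of C w] access_class_nonempty[OF C] w_nonneg
      finite_subset[OF sub finite_V] sub by blast
  let ?t = "1 / graph_radius C w"
  have "1 \<le> (\<Sum>y\<in>C. walk_weight V w k x y * ?t ^ k)" for k
  proof -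
    have "1 = graph_radius C w ^ k * ?t ^ k"
      using r by (simp add: power_one_over)
    also have "\<dots> \<le> (\<Sum>y\<in>C. walk_weight C w k x y) * ?t ^ k"
      using x(2) r by (intro mult_right_mono) auto
    also have "\<dots> = (\<Sum>y\<in>C. walk_weight V w k x y * ?t ^ k)"
      using walk_weight_class[OF C x(1)] by (simp add: sum_distrib_right)
    finally show ?thesis .
  qed
  moreover have "(\<lambda>k. \<Sum>y\<in>C. walk_weight V w k x y * ?t ^ k) \<longlonglongrightarrow> (\<Sum>y\<in>C. 0)"
    using r sub x radius_pos
    by (intro tendsto_sum summable_LIMSEQ_zero H_summable) (auto simp: field_simps)
  ultimately have "(1 :: real) \<le> (\<Sum>y\<in>C. 0)" by (intro LIMSEQ_le_const) auto
  then show False by simp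
qed

text \<open>The class has a radius strictly below \<rho>, so its own walk series converges even at
  \<open>1 / \<rho>\<close>. Its sum there bounds the entry for all smaller \<open>s\<close>, since
  the terms increase with \<open>s\<close>.\<close>

lemma H_nonbasic:
  assumes C: "C \<in> access_classes V w" "\<not> basic_class V w C" and xy: "x \<in> C" "y \<in> C"
  shows "(\<lambda>s. H s x y) \<in> O[near](\<lambda>_. 1)"
proof (rule bigo_nearI)
  fix s assume s: "1 / (2 * \<rho>) < s" "0 < s" "s < 1 / \<rho>"
  note sub = access_class_subset[OF C(1)]
  have "graph_radius C w < \<rho>"
    using class_radius_le[OF C(1)] C by (auto simp: basic_class_def)
  then have sm: "summable (\<lambda>k. walk_weight V w k x y * (1 / \<rho>) ^ k)"
    unfolding walk_weight_class[OF C(1) xy, symmetric]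
    using radius_pos xy sub
    by (intro walk_weight_summable finite_subset[OF sub finite_V] w_nonneg) auto
  have V: "x \<in> V" "y \<in> V" using sub xy by auto
  have "H s x y \<le> (\<Sum>k. walk_weight V w k x y * (1 / \<rho>) ^ k)"
    unfolding H_def using s V sm radius_pos
    by (intro suminf_le[OF _ H_summable sm] mult_left_mono power_mono walk_nonneg) auto
  then show "\<bar>H s x y\<bar> \<le> (\<Sum>k. walk_weight V w k x y * (1 / \<rho>) ^ k) * \<bar>1\<bar>"
    using H_nonneg[of s x y] s V by simp
qed

text \<open>Access from \<open>y\<close> back to \<open>x\<close> moves the estimate to the diagonal
  entry, which is at most a geometric series of ratio \<open>\<rho> * s\<close>.\<close>

lemma H_basic_upper:
  assumes C: "C \<in> access_classes V w" and xy: "x \<in> C" "y \<in> C"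
  shows "(\<lambda>s. H s x y) \<in> O[near](\<lambda>s. 1 / (1 - \<rho> * s))"
proof -
  have V: "x \<in> V" using access_class_subset[OF C] xy by auto
  have "(\<lambda>s. H s x y) \<in> O[near](\<lambda>s. H s x x)"
    using access_class_iff[OF C] xy V by (intro H_harnack_right) auto
  also have "(\<lambda>s. H s x x) \<in> O[near](\<lambda>s. 1 / (1 - \<rho> * s))"
    by (rule bigo_nearI[of _ 1]) (use V H_diag_le H_nonneg in auto)
  finally show ?thesis .
qed

text \<open>The row estimate \<open>\<rho> ^ k\<close> is summed against \<open>s ^ k\<close> into a
  geometric series. It is applied to a basic class and also to \<open>V\<close> itself, the latter
  in order to show that basic classes exist.\<close>

lemma H_row_sum_lower:
  assumes S: "S \<subseteq> V" "S \<noteq> {}" and rad: "graph_radius S w = \<rho>"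
  shows "\<exists>z\<in>S. (\<lambda>s. 1 / (1 - \<rho> * s)) \<in> O[near](\<lambda>s. \<Sum>b\<in>S. H s z b)"
proof -
  obtain z where z: "z \<in> S" "\<And>k. \<rho> ^ k \<le> (\<Sum>y\<in>S. walk_weight S w k z y)"
    using walk_weight_row_ge_graph_radius[of S w] w_nonneg finite_subset[OF S(1) finite_V] S rad
    by auto
  have "(\<lambda>s. 1 / (1 - \<rho> * s)) \<in> O[near](\<lambda>s. \<Sum>b\<in>S. H s z b)"
  proof (rule bigo_nearI[of _ 1])
    fix s assume s: "1 / (2 * \<rho>) < s" "0 < s" "s < 1 / \<rho>" "0 < 1 - \<rho> * s"
    have *: "norm (\<rho> * s) < 1" using s radius_pos by simp
    have sm: "summable (\<lambda>k. walk_weight V w k z b * s ^ k)" if "b \<in> S" for b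
      using s S z that by (intro H_summable) auto
    have "1 / (1 - \<rho> * s) = (\<Sum>k. (\<rho> * s) ^ k)" using suminf_geometric[OF *] by simp
    also have "\<dots> \<le> (\<Sum>k. \<Sum>b\<in>S. walk_weight V w k z b * s ^ k)"
    proof (rule suminf_le)
      show "summable (\<lambda>k. \<Sum>b\<in>S. walk_weight V w k z b * s ^ k)"
        using sm by (rule summable_sum)
      show "summable (\<lambda>k. (\<rho> * s) ^ k)" using * by (rule summable_geometric)
      fix k
      have "(\<Sum>b\<in>S. walk_weight S w k z b) \<le> (\<Sum>b\<in>S. walk_weight V w k z b)"
        using z S w_nonneg by (intro sum_mono walk_weight_mono finite_V) auto
      then have "\<rho> ^ k * s ^ k \<le> (\<Sum>b\<in>S. walk_weight V w k z b) * s ^ k"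
        using z(2)[of k] s by (intro mult_right_mono) auto
      then show "(\<rho> * s) ^ k \<le> (\<Sum>b\<in>S. walk_weight V w k z b * s ^ k)"
        by (simp add: sum_distrib_right power_mult_distrib)
    qed
    also have "\<dots> = (\<Sum>b\<in>S. H s z b)"
      unfolding H_def using sm by (rule suminf_sum)
    finally show "\<bar>1 / (1 - \<rho> * s)\<bar> \<le> 1 * \<bar>\<Sum>b\<in>S. H s z b\<bar>" using s by simp
  qed
  then show ?thesis using z(1) by blast
qed

text \<open>One row of the class has a sum of the right order, and by the two Harnack estimates each
  summand is dominated by the given entry.\<close>

lemma H_basic_lower:
  assumes C: "basic_class V w C" and xy: "x \<in> C" "y \<in> C"
  shows "(\<lambda>s. 1 / (1 - \<rho> * s)) \<in> O[near](\<lambda>s. H s x y)"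
proof -
  have cl: "C \<in> access_classes V w" and rad: "graph_radius C w = \<rho>"
    using C by (auto simp: basic_class_def)
  note sub = access_class_subset[OF cl]
  obtain z where z: "z \<in> C"
      "(\<lambda>s. 1 / (1 - \<rho> * s)) \<in> O[near](\<lambda>s. \<Sum>b\<in>C. H s z b)"
    using H_row_sum_lower[OF sub access_class_nonempty[OF cl] rad] by blast
  note z(2)
  also have "(\<lambda>s. \<Sum>b\<in>C. H s z b) \<in> O[near](\<lambda>s. H s x y)"
  proof (rule big_sum_in_bigo)
    fix b assume b: "b \<in> C"
    have "(\<lambda>s. H s z b) \<in> O[near](\<lambda>s. H s z y)"
      using access_class_iff[OF cl b] xy z sub by (intro H_harnack_right) auto
    also have "(\<lambda>s. H s z y) \<in> O[near](\<lambda>s. H s x y)"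
      using access_class_iff[OF cl xy(1)] xy z sub by (intro H_harnack_left) auto
    finally show "(\<lambda>s. H s z b) \<in> O[near](\<lambda>s. H s x y)" .
  qed
  finally show ?thesis .
qed

text \<open>A walk that leaves an access class never returns, so its exit edge splits it in a unique way.\<close>

lemma H_exit:
  assumes C: "C \<in> access_classes V w" and z: "z \<in> C" and y: "y \<in> V" "y \<notin> C"
    and s: "0 \<le> s" "s < 1 / \<rho>"
  shows "H s z y = s * (\<Sum>a\<in>C. \<Sum>b\<in>V - C. H s z a * w a b * H s b y)"
proof -
  note sub = access_class_subset[OF C]
  have split: "(\<Sum>b\<in>V. f b) = (\<Sum>b\<in>C. f b) + (\<Sum>b\<in>V - C. f b)" for f :: "'v \<Rightarrow> real"
    using sum.subset_diff[OF sub finite_V, of f] by simp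
  have h: "H s x y = s * (\<Sum>b\<in>C. w x b * H s b y) + s * (\<Sum>b\<in>V - C. w x b * H s b y)"
    if "x \<in> C" for x
  proof -
    have "x \<in> V" "x \<noteq> y" using that y sub by auto
    then show ?thesis using H_left[OF s, of x y] y
      by (simp add: split distrib_left)
  qed
  have g: "H s z x = (if z = x then 1 else 0) + s * (\<Sum>b\<in>C. H s z b * w b x)" if x: "x \<in> C" for x
  proof -
    have "H s z b * w b x = 0" if b: "b \<in> V - C" for b
    proof (rule ccontr)
      assume nz: "H s z b * w b x \<noteq> 0"
      have V: "z \<in> V" "x \<in> V" using sub z x by auto
      have "has_access V w z b" using H_eq_0 nz V b by force
      moreover have "has_access V w b x"
        using w_nonneg[of b x] nz V b by (intro has_access_edge) auto
      moreover have "has_access V w x z" using access_class_iff[OF C] z x by metis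
      ultimately have "b \<in> C" using access_class_iff[OF C z] has_access_trans by metis
      then show False using b by simp
    qed
    then have "(\<Sum>b\<in>V - C. H s z b * w b x) = 0" by (intro sum.neutral ballI)
    then show ?thesis using H_right[OF s, of z x] x z sub by (simp add: split subset_iff)
  qed
  \<comment> \<open>The sum of \<open>H s z x * H s x y\<close> over \<open>x\<close> in
    \<open>C\<close> is expanded twice: through \<open>g\<close> in the first factor and through
    \<open>h\<close> in the second. Both expansions contain \<open>?I\<close>, the part in which an
    edge inside \<open>C\<close> is singled out. It cancels and leaves the exit edges.\<close>
  let ?I = "\<Sum>b\<in>C. \<Sum>x\<in>C. s * (H s z b * w b x * H s x y)"
  have "(\<Sum>x\<in>C. H s z x * H s x y)
      = (\<Sum>x\<in>C. (if z = x then H s x y else 0)) + (\<Sum>x\<in>C. \<Sum>b\<in>C. s * (H s z b * w b x * H s x y))"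
    unfolding sum.distrib[symmetric]
    by (intro sum.cong refl, subst g)
      (auto simp: algebra_simps sum_distrib_left sum_distrib_right)
  also have "(\<Sum>x\<in>C. (if z = x then H s x y else 0)) = H s z y"
    using z finite_subset[OF sub finite_V] by simp
  also have "(\<Sum>x\<in>C. \<Sum>b\<in>C. s * (H s z b * w b x * H s x y)) = ?I"
    by (rule sum.swap)
  finally have 1: "(\<Sum>x\<in>C. H s z x * H s x y) = H s z y + ?I" .
  have "(\<Sum>x\<in>C. H s z x * H s x y)
      = ?I + (\<Sum>x\<in>C. \<Sum>b\<in>V - C. s * (H s z x * w x b * H s b y))"
    unfolding sum.distrib[symmetric]
    by (intro sum.cong refl, subst h)
      (auto simp: algebra_simps sum_distrib_left sum_distrib_right)
  with 1 have "H s z y = (\<Sum>x\<in>C. \<Sum>b\<in>V - C. s * (H s z x * w x b * H s b y))" by simp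
  then show ?thesis by (simp add: sum_distrib_left)
qed

end

section \<open>Chains of basic classes between two vertices\<close>

text \<open>The access condition of the theorem, stated for chains of every length so that the
  longest one can measure the order of an entry. Basic chains are nonempty, so \<open>hd\<close> and
  \<open>last\<close> are meaningful.\<close>

definition chain_between :: "'v set \<Rightarrow> ('v \<Rightarrow> 'v \<Rightarrow> real) \<Rightarrow> 'v \<Rightarrow> 'v \<Rightarrow> 'v set list \<Rightarrow> bool" where
  "chain_between V w x y Ls \<longleftrightarrow> basic_chain V w Ls \<and>
    (\<forall>l\<in>hd Ls. has_access V w x l) \<and> (\<forall>l\<in>last Ls. has_access V w l y)"

text \<open>The edge chosen is the first one of the path that ends outside \<open>C\<close>.\<close>

lemma has_access_exit:
  assumes "has_access V w c m" "c \<in> C" "m \<notin> C" "C \<subseteq> V"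
  shows "\<exists>a\<in>C. \<exists>b\<in>V - C. 0 < w a b \<and> has_access V w b m"
proof -
  have "(c, m) \<in> (edges V w)\<^sup>*" "m \<in> V" using assms(1) by (auto simp: has_access_def)
  then show ?thesis using assms(2)
  proof (induction rule: converse_rtrancl_induct)
    case base
    then show ?case using assms(3) by simp
  next
    case (step u v)
    show ?case
    proof (cases "v \<in> C")
      case False
      then show ?thesis using step by (auto simp: edges_def has_access_def)
    qed (use step in auto)
  qed
qed

text \<open>Distinctness is the point: \<open>b\<close> has access to every vertex of every class of
  \<open>Ls\<close>, by passing down the chain, but it has no access to \<open>x\<close>. Hence
  \<open>C\<close> does not occur in \<open>Ls\<close>.\<close>

lemma chain_between_Cons:
  assumes Ls: "chain_between V w b y Ls" and C: "basic_class V w C" "x \<in> C"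
    and xb: "has_access V w x b" and bx: "\<not> has_access V w b x"
  shows "chain_between V w x y (C # Ls)"
proof -
  have cl: "C \<in> access_classes V w" using C by (simp add: basic_class_def)
  have ne: "Ls \<noteq> []" and bc: "basic_chain V w Ls"
    using Ls by (auto simp: chain_between_def basic_chain_def)
  have hd: "\<forall>l\<in>hd Ls. has_access V w b l" using Ls by (simp add: chain_between_def)
  have reach: "has_access V w b l" if "successively (class_access V w) Ms" "Ms \<noteq> []"
      "\<forall>L\<in>set Ms. basic_class V w L" "\<forall>l\<in>hd Ms. has_access V w b l" "M \<in> set Ms" "l \<in> M" for Ms M l
    using that
  proof (induction Ms)
    case (Cons N Ms)
    show ?case
    proof (cases "M = N")
      case False
      then have nem: "Ms \<noteq> []" using Cons.prems by auto
      have "N \<noteq> {}" using Cons.prems access_class_nonempty by (auto simp: basic_class_def)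
      then obtain n where n: "n \<in> N" by auto
      have "class_access V w N (hd Ms)" using Cons.prems nem by (cases Ms) auto
      then have "\<forall>l\<in>hd Ms. has_access V w b l"
        using n Cons.prems(4) by (auto simp: class_access_def intro: has_access_trans)
      then show ?thesis using Cons nem False by (cases Ms) auto
    qed (use Cons in auto)
  qed simp
  have "C \<notin> set Ls" using reach[of Ls C x] ne bc hd C bx by (auto simp: basic_chain_def)
  moreover have "class_access V w C (hd Ls)"
    unfolding class_access_def
  proof (intro ballI)
    fix c l assume "c \<in> C" "l \<in> hd Ls"
    then have "has_access V w c x" "has_access V w b l"
      using access_class_iff[OF cl C(2)] hd by auto
    then show "has_access V w c l" using xb has_access_trans by metis
  qed
  moreover have "has_access V w x l" if "l \<in> C" for l
    using access_class_iff[OF cl C(2)] that by auto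
  ultimately show ?thesis
    using Ls C(1) ne by (cases Ls) (auto simp: chain_between_def basic_chain_def)
qed

section \<open>Exact order of an entry of the growth matrix\<close>

context growth
begin

text \<open>Induction on the number of vertices accessible from \<open>x\<close>. If
  \<open>y\<close> lies in the class \<open>C\<close> of \<open>x\<close>, the estimates for a
  single class apply. Otherwise \<open>H_exit\<close> reduces the entry to products
  \<open>H s x a * w a b * H s b y\<close> with \<open>b\<close> outside \<open>C\<close>. For basic
  \<open>C\<close> the first factor costs one power of \<open>1 / (1 - \<rho> * s)\<close>, while
  every chain from \<open>b\<close> can be prolonged by \<open>C\<close> and so has length at most
  \<open>p - 1\<close>. For nonbasic \<open>C\<close> the first factor is bounded, and the chains
  from \<open>b\<close> are chains from \<open>x\<close>.\<close>

lemma H_upper: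
  assumes "x \<in> V" "y \<in> V" "\<And>Ls. chain_between V w x y Ls \<Longrightarrow> length Ls \<le> p"
  shows "(\<lambda>s. H s x y) \<in> O[near](\<lambda>s. (1 / (1 - \<rho> * s)) ^ p)"
  using assms
proof (induction "card {z. has_access V w x z}" arbitrary: x p rule: less_induct)
  case less
  note x = less.prems(1) and y = less.prems(2) and chains = less.prems(3)
  obtain C where C: "C \<in> access_classes V w" and xC: "x \<in> C"
    using access_class_exists[OF x] by blast
  note sub = access_class_subset[OF C]
  let ?D = "\<lambda>s. 1 / (1 - \<rho> * s)"
  have mono: "(\<lambda>s. ?D s ^ i) \<in> O[near](\<lambda>s. ?D s ^ j)" if "i \<le> j" for i j
  proof (rule bigo_nearI[of _ 1])
    fix s assume s: "0 < s" "0 < 1 - \<rho> * s"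
    then have "1 \<le> ?D s" using radius_pos by simp
    then have "?D s ^ i \<le> ?D s ^ j" using that by (intro power_increasing) auto
    then show "\<bar>?D s ^ i\<bar> \<le> 1 * \<bar>?D s ^ j\<bar>" using s by simp
  qed
  have basic_singleton: "chain_between V w x y [C]" if "basic_class V w C" "has_access V w x y"
    using that xC access_class_iff[OF C xC]
    by (auto simp: chain_between_def basic_chain_def intro: has_access_trans)
  show ?case
  proof (cases "has_access V w x y")
    case False
    then show ?thesis using H_eq_0[OF x y] by simp
  next
    case True
    show ?thesis
    proof (cases "y \<in> C")
      case y: True
      show ?thesis
      proof (cases "basic_class V w C")
        case basic: True
        then have "1 \<le> p" using chains[OF basic_singleton] True by simp
        then have "(\<lambda>s. ?D s ^ 1) \<in> O[near](\<lambda>s. ?D s ^ p)" by (rule mono)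
        then show ?thesis
          using H_basic_upper[OF C xC y] landau_o.big_trans[of "\<lambda>s. H s x y"] by simp
      next
        case False
        have "(\<lambda>s. ?D s ^ 0) \<in> O[near](\<lambda>s. ?D s ^ p)" by (rule mono) simp
        then show ?thesis
          using H_nonbasic[OF C False xC y] landau_o.big_trans[of "\<lambda>s. H s x y"] by simp
      qed
    next
      case yC: False
      have summand: "(\<lambda>s. H s x a * w a b * H s b y) \<in> O[near](\<lambda>s. ?D s ^ p)"
        if a: "a \<in> C" and b: "b \<in> V - C" for a b
      proof (cases "w a b \<noteq> 0 \<and> has_access V w b y")
        case False
        then show ?thesis using H_eq_0[of b y] b y by auto
      next
        case pos: True
        have ab: "has_access V w a b"
          using w_nonneg[of a b] a b sub pos by (intro has_access_edge) auto
        have xa: "has_access V w x a" using access_class_iff[OF C xC] a by auto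
        have xb: "has_access V w x b" using xa ab by (rule has_access_trans)
        have bx: "\<not> has_access V w b x" using access_class_iff[OF C xC] b xb by auto
        \<comment> \<open>The inclusion is strict because \<open>x\<close> itself is no longer
          accessible after the exit from \<open>C\<close>.\<close>
        have "{z. has_access V w b z} \<subset> {z. has_access V w x z}"
          using xb bx has_access_trans[of V w x b] has_access_refl[OF x] by blast
        moreover have "finite {z. has_access V w x z}"
          by (rule finite_subset[OF _ finite_V]) (auto simp: has_access_def)
        ultimately have lt: "card {z. has_access V w b z} < card {z. has_access V w x z}"
          by (rule psubset_card_mono[rotated])
        show ?thesis
        proof (cases "basic_class V w C")
          case basic: True
          have "chain_between V w x y (C # Ls)" if "chain_between V w b y Ls" for Ls
            using that basic xC xb bx by (rule chain_between_Cons)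
          then have "length Ls \<le> p - 1" if "chain_between V w b y Ls" for Ls
            using chains[of "C # Ls"] that by force
          then have "(\<lambda>s. H s b y) \<in> O[near](\<lambda>s. ?D s ^ (p - 1))"
            using less.hyps[OF lt] b y by auto
          moreover have "(\<lambda>s. H s x a) \<in> O[near](?D)" by (rule H_basic_upper[OF C xC a])
          ultimately have "(\<lambda>s. H s x a * H s b y) \<in> O[near](\<lambda>s. ?D s * ?D s ^ (p - 1))"
            by (intro landau_o.big.mult)
          \<comment> \<open>The chain \<open>[C]\<close> rules out \<open>p = 0\<close>, where
            truncated subtraction would leave one power too many.\<close>
          moreover have "1 \<le> p" using chains[OF basic_singleton] basic True by simp
          ultimately have "(\<lambda>s. H s x a * H s b y) \<in> O[near](\<lambda>s. ?D s ^ p)"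
            by (cases p) simp_all
          then have "(\<lambda>s. w a b * (H s x a * H s b y)) \<in> O[near](\<lambda>s. ?D s ^ p)" by simp
          then show ?thesis by (simp add: mult_ac)
        next
          case False
          have "chain_between V w x y Ls" if "chain_between V w b y Ls" for Ls
            using that xb unfolding chain_between_def by (blast intro: has_access_trans)
          then have "(\<lambda>s. H s b y) \<in> O[near](\<lambda>s. ?D s ^ p)"
            using less.hyps[OF lt] chains b y by auto
          then have "(\<lambda>s. H s x a * H s b y) \<in> O[near](\<lambda>s. 1 * ?D s ^ p)"
            by (intro landau_o.big.mult H_nonbasic[OF C False xC a])
          then have "(\<lambda>s. w a b * (H s x a * H s b y)) \<in> O[near](\<lambda>s. ?D s ^ p)" by simp
          then show ?thesis by (simp add: mult_ac)
        qed
      qed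
      have "(\<lambda>s. s) \<in> O[near](\<lambda>_. 1)" by (rule bigo_nearI[of _ "1 / \<rho>"]) auto
      then have "(\<lambda>s. s * (\<Sum>a\<in>C. \<Sum>b\<in>V - C. H s x a * w a b * H s b y))
          \<in> O[near](\<lambda>s. 1 * ?D s ^ p)"
        using summand by (intro landau_o.big.mult big_sum_in_bigo) auto
      moreover have "eventually (\<lambda>s. H s x y
          = s * (\<Sum>a\<in>C. \<Sum>b\<in>V - C. H s x a * w a b * H s b y)) near"
        by (rule nearI) (intro H_exit C xC y yC, auto)
      ultimately show ?thesis
        using landau_o.big.in_cong[of "\<lambda>s. H s x y"] by (simp only: mult_1)
    qed
  qed
qed

text \<open>Induction along the chain. Let an edge from \<open>a\<close> to \<open>b\<close> leave
  the first class \<open>C\<close> on the way to the next one. Then the remaining classes form a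
  chain from \<open>b\<close> to \<open>y\<close>, and the single term of this edge in the
  nonnegative sum of \<open>H_exit\<close> already has the required order. Access from
  \<open>x\<close> to \<open>y\<close> is carried through the induction because access from
  \<open>b\<close> to \<open>y\<close> yields that \<open>y\<close> lies outside \<open>C\<close>,
  as \<open>H_exit\<close> requires.\<close>

lemma H_lower:
  assumes "chain_between V w x y Ls" "x \<in> V" "y \<in> V"
  shows "has_access V w x y \<and> (\<lambda>s. (1 / (1 - \<rho> * s)) ^ length Ls) \<in> O[near](\<lambda>s. H s x y)"
  using assms
proof (induction Ls arbitrary: x)
  case Nil
  then show ?case by (simp add: chain_between_def basic_chain_def)
next
  case (Cons C Ls)
  have basic: "basic_class V w C"
    using Cons.prems by (simp add: chain_between_def basic_chain_def)
  then have C: "C \<in> access_classes V w" by (simp add: basic_class_def)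
  note sub = access_class_subset[OF C]
  obtain c where c: "c \<in> C" using access_class_nonempty[OF C] by auto
  have xc: "has_access V w x c" using Cons.prems c by (simp add: chain_between_def)
  let ?D = "\<lambda>s. 1 / (1 - \<rho> * s)"
  show ?case
  proof (cases "Ls = []")
    case True
    have cy: "has_access V w c y" using Cons.prems True c by (simp add: chain_between_def)
    have "?D \<in> O[near](\<lambda>s. H s c c)" by (rule H_basic_lower[OF basic c c])
    also have "(\<lambda>s. H s c c) \<in> O[near](\<lambda>s. H s x c)"
      using xc c sub by (intro H_harnack_left) auto
    also have "(\<lambda>s. H s x c) \<in> O[near](\<lambda>s. H s x y)"
      using cy Cons.prems by (intro H_harnack_right) auto
    finally show ?thesis using True xc cy has_access_trans by fastforce
  next
    case False
    then obtain M Ms where Ls: "Ls = M # Ms" by (cases Ls) auto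
    have M: "M \<in> access_classes V w" and "C \<noteq> M" and acc: "class_access V w C M"
      using Cons.prems by (auto simp: Ls chain_between_def basic_chain_def basic_class_def)
    obtain m where m: "m \<in> M" using access_class_nonempty[OF M] by auto
    have mC: "m \<notin> C" using access_class_eqI[OF C M] m \<open>C \<noteq> M\<close> by auto
    have "has_access V w c m" using acc c m by (simp add: class_access_def)
    then obtain a b where a: "a \<in> C" and b: "b \<in> V - C" and ab: "0 < w a b"
      and bm: "has_access V w b m"
      using has_access_exit[OF _ c mC sub] by blast
    have bV: "b \<in> V" and aV: "a \<in> V" using a b sub by auto
    have "has_access V w b l" if "l \<in> M" for l
      using access_class_iff[OF M m] that bm has_access_trans by metis
    then have "chain_between V w b y Ls"
      using Cons.prems by (auto simp: Ls chain_between_def basic_chain_def)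
    from Cons.IH[OF this bV Cons.prems(3)]
    have byy: "has_access V w b y" and IH: "(\<lambda>s. ?D s ^ length Ls) \<in> O[near](\<lambda>s. H s b y)"
      by auto
    have ab': "has_access V w a b" using aV bV ab by (rule has_access_edge)
    have ca: "has_access V w c a" "has_access V w a c" using access_class_iff[OF C] c a by auto
    have yC: "y \<notin> C"
    proof
      assume "y \<in> C"
      then have "has_access V w y a" using access_class_iff[OF C] a by auto
      then have "has_access V w b a" using byy has_access_trans by metis
      then show False using ab' b access_class_iff[OF C a] by auto
    qed
    have "(\<lambda>s. ?D s * ?D s ^ length Ls) \<in> O[near](\<lambda>s. H s c a * H s b y)"
      by (intro landau_o.big.mult H_basic_lower[OF basic c a] IH)
    also have "(\<lambda>s. H s c a * H s b y) \<in> O[near](\<lambda>s. H s c y)"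
    proof (rule bigo_nearI)
      fix s assume s: "1 / (2 * \<rho>) < s" "0 < s" "s < 1 / \<rho>"
      have nn: "0 \<le> H s c a' * w a' b' * H s b' y" if "a' \<in> C" "b' \<in> V - C" for a' b'
        using that s c sub Cons.prems(3) w_nonneg H_nonneg by (auto simp: subset_iff)
      have "1 / (2 * \<rho>) * (H s c a * w a b * H s b y) \<le> s * (H s c a * w a b * H s b y)"
        using s nn[OF a b] by (intro mult_right_mono) auto
      also have "H s c a * w a b * H s b y \<le> (\<Sum>b'\<in>V - C. H s c a * w a b' * H s b' y)"
        using nn a b finite_V
        by (intro member_le_sum[where f = "\<lambda>b'. H s c a * w a b' * H s b' y"]) auto
      also have "\<dots> \<le> (\<Sum>a'\<in>C. \<Sum>b'\<in>V - C. H s c a' * w a' b' * H s b' y)"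
        using nn a finite_subset[OF sub finite_V]
        by (intro member_le_sum[where f = "\<lambda>a'. \<Sum>b'\<in>V - C. H s c a' * w a' b' * H s b' y"])
          (auto intro: sum_nonneg)
      also have "s * \<dots> = H s c y"
        using H_exit[OF C c Cons.prems(3) yC, of s] s by simp
      finally have "1 / (2 * \<rho>) * (H s c a * w a b * H s b y) \<le> H s c y"
        using s by simp
      then have "H s c a * H s b y \<le> (2 * \<rho> / w a b) * H s c y"
        using ab radius_pos by (simp add: field_simps)
      then show "\<bar>H s c a * H s b y\<bar> \<le> (2 * \<rho> / w a b) * \<bar>H s c y\<bar>"
        using s c aV bV sub Cons.prems H_nonneg by (auto simp: subset_iff abs_mult)
    qed
    also have "(\<lambda>s. H s c y) \<in> O[near](\<lambda>s. H s x y)"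
      using xc Cons.prems by (intro H_harnack_left) auto
    finally have "(\<lambda>s. ?D s ^ length (C # Ls)) \<in> O[near](\<lambda>s. H s x y)" by simp
    moreover have "has_access V w x y"
      using xc ca ab' byy has_access_trans by metis
    ultimately show ?thesis by blast
  qed
qed

end

section \<open>Limits from rationality and boundedness\<close>

text \<open>If \<open>Q\<close> does not vanish at \<open>a\<close>, the quotient of the polynomials
  is continuous there. If it does, boundedness of \<open>f\<close> makes
  \<open>poly Q s * f s\<close> tend to 0, so \<open>P\<close> vanishes at \<open>a\<close> too. A
  common factor of root \<open>a\<close> is then cancelled, which lowers the degree of
  \<open>Q\<close>.\<close>

lemma rational_bounded_tendsto:
  fixes P Q :: "real poly" and f :: "real \<Rightarrow> real"
  assumes "Q \<noteq> 0" "eventually (\<lambda>s. poly Q s * f s = poly P s) (at_left a)"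
    and "f \<in> O[at_left a](\<lambda>_. 1)"
  shows "\<exists>L. (f \<longlongrightarrow> L) (at_left a)"
  using assms(1,2)
proof (induction "degree Q" arbitrary: P Q rule: less_induct)
  case less
  have cont: "((\<lambda>s. poly R s) \<longlongrightarrow> poly R a) (at_left a)" for R :: "real poly"
    by (intro tendsto_intros)
  show ?case
  proof (cases "poly Q a = 0")
    case False
    have "((\<lambda>s. poly P s / poly Q s) \<longlongrightarrow> poly P a / poly Q a) (at_left a)"
      using False by (intro tendsto_divide cont)
    moreover have "eventually (\<lambda>s. poly Q s \<noteq> 0) (at_left a)"
      using tendsto_imp_eventually_ne[OF cont False] .
    with less.prems(2) have "eventually (\<lambda>s. poly P s / poly Q s = f s) (at_left a)"
      by eventually_elim (auto simp: field_simps)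
    ultimately show ?thesis by (intro exI) (rule Lim_transform_eventually)
  next
    case True
    have "(\<lambda>s. poly Q s) \<in> o[at_left a](\<lambda>_. 1)"
      using cont[of Q] True by (intro smalloI_tendsto) auto
    then have "(\<lambda>s. poly Q s * f s) \<in> o[at_left a](\<lambda>_. 1 * 1)"
      using assms(3) by (rule landau_o.small_big_mult)
    then have "((\<lambda>s. poly Q s * f s) \<longlongrightarrow> 0) (at_left a)"
      using smalloD_tendsto by fastforce
    then have "((\<lambda>s. poly P s) \<longlongrightarrow> 0) (at_left a)"
      using less.prems(2) by (rule Lim_transform_eventually)
    then have "poly P a = 0"
      by (rule tendsto_unique[OF trivial_limit_at_left_real cont])
    then obtain P' Q' where PQ: "P = [:-a, 1:] * P'" "Q = [:-a, 1:] * Q'"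
      using True by (auto simp: poly_eq_0_iff_dvd elim!: dvdE)
    have "Q' \<noteq> 0" using PQ less.prems(1) by auto
    then have "degree Q = Suc (degree Q')" unfolding PQ by (subst degree_mult_eq) auto
    moreover have "eventually (\<lambda>s. s < a) (at_left a)"
      by (simp add: eventually_at_filter)
    with less.prems(2) have "eventually (\<lambda>s. poly Q' s * f s = poly P' s) (at_left a)"
    proof eventually_elim
      case (elim s)
      then have "(s - a) * (poly Q' s * f s) = (s - a) * poly P' s"
        unfolding PQ poly_mult by (simp add: algebra_simps)
      then show ?case using elim by simp
    qed
    ultimately show ?thesis using less.hyps[of Q' P'] \<open>Q' \<noteq> 0\<close> by simp
  qed
qed

lemma finite_access_classes: "finite V \<Longrightarrow> finite (access_classes V w)"
  unfolding access_classes_def by (rule finite_quotient) (auto simp: has_access_def)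

context growth
begin

text \<open>Cramer's rule for the polynomial matrix I - X F, called \<open>M\<close> below: where
  the series converge, \<open>H\<close> is its inverse. Thus \<open>det M\<close> is a common
  denominator, and it is nonzero because \<open>M\<close> evaluates to the identity at 0.\<close>

lemma H_rational:
  "\<exists>Q. Q \<noteq> 0 \<and> (\<forall>x\<in>V. \<forall>y\<in>V. \<exists>P. \<forall>s. 0 < s \<longrightarrow> s < 1 / \<rho> \<longrightarrow> poly Q s * H s x y = poly P s)"
proof -
  let ?n = "card V" and ?v = "from_nat_into V" and ?i = "to_nat_on V"
  define q where "q = (\<lambda>x a. [: if x = a then 1 else 0, - w x a :])"
  define M where "M = mat ?n ?n (\<lambda>(i, j). q (?v i) (?v j))"
  have M: "M \<in> carrier_mat ?n ?n" by (simp add: M_def)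
  \<comment> \<open>This is the adjugate of \<open>M\<close>, not an adjacency matrix.\<close>
  define B where "B = Determinant.adj_mat M"
  have B: "B \<in> carrier_mat ?n ?n" "M * B = det M \<cdot>\<^sub>m 1\<^sub>m ?n"
    unfolding B_def by (rule adj_mat[OF M])+
  have v_eq: "?v i = ?v j \<longleftrightarrow> i = j" if "i < ?n" "j < ?n" for i j
    using bij_betw_from_nat_into_finite[OF finite_V] that by (auto simp: bij_betw_def inj_on_def)
  have iv: "?v (?i x) = x" "?i x < ?n" if "x \<in> V" for x
    using that finite_V by (auto simp: countable_finite to_nat_on_less)
  have "poly (det M) 0 = det (1\<^sub>m ?n)"
    by (rule poly_det_cong[of _ ?n]) (auto simp: M_def q_def v_eq)
  then have det: "det M \<noteq> 0" by auto
  have MB: "(\<Sum>a\<in>V. q x a * B $$ (?i a, ?i y)) = (if x = y then det M else 0)"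
    if x: "x \<in> V" and y: "y \<in> V" for x y
  proof -
    have "(M * B) $$ (?i x, ?i y) = (\<Sum>l\<in>{0..<?n}. M $$ (?i x, l) * B $$ (l, ?i y))"
      using iv[OF x] iv[OF y] M B(1) by (simp add: scalar_prod_def)
    also have "\<dots> = (\<Sum>l\<in>{0..<?n}. q x (?v l) * B $$ (?i (?v l), ?i y))"
    proof (rule sum.cong)
      fix l assume "l \<in> {0..<?n}"
      then have l: "l < ?n" by simp
      then have "?v l \<in> V" using x by (intro from_nat_into) auto
      then have "?i (?v l) = l" using v_eq[of "?i (?v l)" l] iv l by auto
      then show "M $$ (?i x, l) * B $$ (l, ?i y) = q x (?v l) * B $$ (?i (?v l), ?i y)"
        using l iv[OF x] by (simp add: M_def)
    qed simp
    also have "\<dots> = (\<Sum>a\<in>V. q x a * B $$ (?i a, ?i y))"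
      by (rule sum_from_nat_into[OF finite_V])
    finally show ?thesis
      unfolding B(2) using iv[OF x] iv[OF y] x y
      by (auto simp: countable_finite finite_V split: if_splits)
  qed
  have "poly (det M) s * H s x y = poly (B $$ (?i x, ?i y)) s"
    if x: "x \<in> V" and y: "y \<in> V" and s: "0 < s" "s < 1 / \<rho>" for x y s
  proof -
    let ?b = "\<lambda>a. poly (B $$ (?i a, ?i y)) s"
    have q: "(\<Sum>z\<in>V. H s x z * poly (q z a) s) = (if x = a then 1 else 0)" if a: "a \<in> V" for a
    proof -
      have "(\<Sum>z\<in>V. H s x z * poly (q z a) s)
          = (\<Sum>z\<in>V. (if z = a then H s x z else 0) - s * (H s x z * w z a))"
        by (intro sum.cong) (auto simp: q_def algebra_simps)
      also have "\<dots> = H s x a - s * (\<Sum>z\<in>V. H s x z * w z a)"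
        using a finite_V by (simp add: sum_subtractf sum_distrib_left)
      finally show ?thesis using H_right[of s x a] s x a by simp
    qed
    \<comment> \<open>Associativity of the product H M B: the factor M B is \<open>det M\<close>
      times the identity, while H M is the identity by \<open>q\<close>.\<close>
    have "(\<Sum>z\<in>V. H s x z * (\<Sum>a\<in>V. poly (q z a) s * ?b a))
        = (\<Sum>z\<in>V. H s x z * poly (if z = y then det M else 0) s)"
      by (intro sum.cong refl, subst MB[OF _ y, symmetric]) (simp_all add: poly_sum)
    also have "\<dots> = (\<Sum>z\<in>V. if z = y then H s x z * poly (det M) s else 0)"
      by (intro sum.cong) auto
    also have "\<dots> = H s x y * poly (det M) s"
      using y finite_V by simp
    finally have 1: "(\<Sum>z\<in>V. H s x z * (\<Sum>a\<in>V. poly (q z a) s * ?b a)) = H s x y * poly (det M) s" .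
    have "(\<Sum>z\<in>V. H s x z * (\<Sum>a\<in>V. poly (q z a) s * ?b a))
        = (\<Sum>z\<in>V. \<Sum>a\<in>V. (H s x z * poly (q z a) s) * ?b a)"
      by (simp add: sum_distrib_left mult.assoc)
    also have "\<dots> = (\<Sum>a\<in>V. \<Sum>z\<in>V. (H s x z * poly (q z a) s) * ?b a)"
      by (rule sum.swap)
    also have "\<dots> = (\<Sum>a\<in>V. (if x = a then 1 else 0) * ?b a)"
      by (intro sum.cong refl) (simp only: sum_distrib_right[symmetric] q)
    also have "\<dots> = (\<Sum>a\<in>V. if x = a then ?b a else 0)"
      by (intro sum.cong) auto
    also have "\<dots> = ?b x" using x finite_V by simp
    finally show ?thesis using 1 by (simp add: mult.commute)
  qed
  then have "\<forall>x\<in>V. \<forall>y\<in>V. \<exists>P. \<forall>s. 0 < s \<longrightarrow> s < 1 / \<rho> \<longrightarrow> poly (det M) s * H s x y = poly P s"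
    by meson
  with det show ?thesis by (intro exI[of _ "det M"] conjI)
qed

lemma gap_tendsto: "((\<lambda>s. 1 - \<rho> * s) \<longlongrightarrow> 0) near"
proof -
  have "((\<lambda>s. 1 - \<rho> * s) \<longlongrightarrow> 1 - \<rho> * (1 / \<rho>)) near"
    unfolding near_at_left by (intro tendsto_intros)
  then show ?thesis using radius_pos by simp
qed

lemma scaled_bigo:
  fixes f :: "real \<Rightarrow> real"
  assumes "f \<in> O[near](\<lambda>s. (1 / (1 - \<rho> * s)) ^ p)" "p \<le> m"
  shows "(\<lambda>s. (1 - \<rho> * s) ^ m * f s) \<in> O[near](\<lambda>s. (1 - \<rho> * s) ^ (m - p))"
proof -
  have "(\<lambda>s. (1 - \<rho> * s) ^ m * f s) \<in> O[near](\<lambda>s. (1 - \<rho> * s) ^ m * (1 / (1 - \<rho> * s)) ^ p)"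
    using assms(1) by (intro landau_o.big.mult) auto
  also have "eventually (\<lambda>s. (1 - \<rho> * s) ^ m * (1 / (1 - \<rho> * s)) ^ p = (1 - \<rho> * s) ^ (m - p)) near"
    by (rule nearI) (use assms(2) in \<open>simp add: power_diff power_one_over\<close>)
  finally show ?thesis .
qed

lemma scaled_tendsto_0:
  fixes f :: "real \<Rightarrow> real"
  assumes "f \<in> O[near](\<lambda>s. (1 / (1 - \<rho> * s)) ^ p)" "p < m"
  shows "((\<lambda>s. (1 - \<rho> * s) ^ m * f s) \<longlongrightarrow> 0) near"
proof -
  have "((\<lambda>s. (1 - \<rho> * s) ^ (m - p)) \<longlongrightarrow> 0 ^ (m - p)) near"
    by (intro tendsto_power gap_tendsto)
  then have "(\<lambda>s. (1 - \<rho> * s) ^ (m - p)) \<in> o[near](\<lambda>_. 1)"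
    using assms(2) by (intro smalloI_tendsto) (auto simp: zero_power)
  with scaled_bigo[OF assms(1) less_imp_le[OF assms(2)]]
  have "(\<lambda>s. (1 - \<rho> * s) ^ m * f s) \<in> o[near](\<lambda>_. 1)"
    by (rule landau_o.big_small_trans)
  then show ?thesis using smalloD_tendsto by fastforce
qed

text \<open>A zero limit would force the product of \<open>(1 - \<rho> * s) ^ m\<close> and its
  reciprocal, which is constantly 1 near \<open>1 / \<rho>\<close>, to tend to 0.\<close>

lemma scaled_tendsto_nonzero:
  fixes f :: "real \<Rightarrow> real"
  assumes "(\<lambda>s. (1 / (1 - \<rho> * s)) ^ m) \<in> O[near](f)"
    and "((\<lambda>s. (1 - \<rho> * s) ^ m * f s) \<longlongrightarrow> L) near"
  shows "L \<noteq> 0"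
proof
  assume "L = 0"
  then have "(\<lambda>s. (1 - \<rho> * s) ^ m * f s) \<in> o[near](\<lambda>_. 1 :: real)"
    using assms(2) by (intro smalloI_tendsto) auto
  moreover have "(\<lambda>s. (1 - \<rho> * s) ^ m * (1 / (1 - \<rho> * s)) ^ m) \<in> O[near](\<lambda>s. (1 - \<rho> * s) ^ m * f s)"
    using assms(1) by (intro landau_o.big.mult) auto
  ultimately have "(\<lambda>s. (1 - \<rho> * s) ^ m * (1 / (1 - \<rho> * s)) ^ m) \<in> o[near](\<lambda>_. 1 :: real)"
    by (rule landau_o.big_small_trans[rotated])
  then have "((\<lambda>s. (1 - \<rho> * s) ^ m * (1 / (1 - \<rho> * s)) ^ m) \<longlongrightarrow> 0) near"
    using smalloD_tendsto by fastforce
  moreover have "eventually (\<lambda>s. (1 - \<rho> * s) ^ m * (1 / (1 - \<rho> * s)) ^ m = 1) near"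
    by (rule nearI) (simp add: power_one_over)
  ultimately have "((\<lambda>_. 1 :: real) \<longlongrightarrow> 0) near"
    by (rule Lim_transform_eventually)
  then show False using near_nontrivial by (simp add: tendsto_const_iff)
qed

section \<open>Dominant chains and the height\<close>

text \<open>Otherwise \<open>H_upper\<close> with \<open>p = 0\<close> would bound every entry,
  hence every row sum, against \<open>H_row_sum_lower\<close> for the whole of
  \<open>V\<close>.\<close>

lemma basic_chain_exists: "\<exists>Ls. basic_chain V w Ls"
proof (rule ccontr)
  assume none: "\<not> ?thesis"
  then have "(\<lambda>s. H s x y) \<in> O[near](\<lambda>s. (1 / (1 - \<rho> * s)) ^ 0)" if "x \<in> V" "y \<in> V" for x y
    using that by (intro H_upper) (auto simp: chain_between_def)
  then have bounded: "(\<lambda>s. \<Sum>b\<in>V. H s z b) \<in> O[near](\<lambda>s. (1 / (1 - \<rho> * s)) ^ 0)" if "z \<in> V" for z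
    using that by (intro big_sum_in_bigo)
  have "V \<noteq> {}" using radius_pos by (auto simp: graph_radius_def)
  then obtain z where "z \<in> V" "(\<lambda>s. 1 / (1 - \<rho> * s)) \<in> O[near](\<lambda>s. \<Sum>b\<in>V. H s z b)"
    using H_row_sum_lower[of V] by auto
  then show False
    using scaled_tendsto_nonzero[of 1 "\<lambda>s. \<Sum>b\<in>V. H s z b" 0] scaled_tendsto_0[OF bounded, of z 1]
    by simp
qed

lemma dominant_chain_exists: "\<exists>Ls. dominant_chain V w Ls"
proof -
  have "length Ls \<le> card (access_classes V w)" if "basic_chain V w Ls" for Ls
  proof -
    have "length Ls = card (set Ls)"
      using that by (simp add: basic_chain_def distinct_card)
    also have "\<dots> \<le> card (access_classes V w)"
      using that finite_V by (intro card_mono finite_access_classes)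
        (auto simp: basic_chain_def basic_class_def)
    finally show ?thesis .
  qed
  moreover obtain Ms where "basic_chain V w Ms" using basic_chain_exists by blast
  ultimately show ?thesis
    using ex_has_greatest_nat[of "basic_chain V w" Ms length "Suc (card (access_classes V w))"]
    unfolding dominant_chain_def by (simp add: less_Suc_eq_le)
qed

text \<open>Two dominant chains bound each other's length, so exactly one number meets the
  description that defines \<open>height\<close>.\<close>

lemma length_dominant_chain:
  assumes "dominant_chain V w Ls"
  shows "length Ls = height V w"
  unfolding height_def
proof (rule the_equality[symmetric])
  fix h assume "\<exists>Ms. dominant_chain V w Ms \<and> length Ms = h"
  then obtain Ms where "dominant_chain V w Ms" "length Ms = h" by blast
  then show "h = length Ls" using assms unfolding dominant_chain_def by (meson order_antisym)
qed (use assms in blast)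

text \<open>Maximality becomes an equation of lengths, the form in which chains enter the limit of
  an entry.\<close>

lemma dominant_chain_iff: "dominant_chain V w Ls \<longleftrightarrow> basic_chain V w Ls \<and> length Ls = height V w"
proof -
  obtain Ms where Ms: "dominant_chain V w Ms" using dominant_chain_exists by blast
  then have "length Ms = height V w" by (rule length_dominant_chain)
  moreover have "length Ls = length Ms" if "dominant_chain V w Ls"
    using length_dominant_chain[OF that] length_dominant_chain[OF Ms] by simp
  ultimately show ?thesis
    using Ms unfolding dominant_chain_def by metis
qed

lemma basic_chain_length_le: "basic_chain V w Ls \<Longrightarrow> length Ls \<le> height V w"
proof -
  assume Ls: "basic_chain V w Ls"
  obtain Ms where Ms: "dominant_chain V w Ms" using dominant_chain_exists by blast
  then have "length Ls \<le> length Ms" using Ls unfolding dominant_chain_def by blast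
  then show ?thesis using length_dominant_chain[OF Ms] by simp
qed

lemma height_pos: "0 < height V w"
proof -
  obtain Ls where "dominant_chain V w Ls" using dominant_chain_exists by blast
  then show ?thesis by (cases Ls) (auto simp: dominant_chain_iff basic_chain_def)
qed

lemma H_bigo_height:
  "x \<in> V \<Longrightarrow> y \<in> V \<Longrightarrow> (\<lambda>s. H s x y) \<in> O[near](\<lambda>s. (1 / (1 - \<rho> * s)) ^ height V w)"
  by (rule H_upper) (simp_all add: chain_between_def basic_chain_length_le)

section \<open>Limits of the scaled entries and the residual matrix\<close>

text \<open>The scaled entry is bounded and rational, so it converges. If no chain from
  \<open>x\<close> to \<open>y\<close> has the full length, \<open>H_upper\<close> leaves a spare
  factor \<open>1 - \<rho> * s\<close> and the limit is 0; a chain of full length excludes 0 by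
  \<open>H_lower\<close>.\<close>

lemma H_scaled_limit:
  assumes x: "x \<in> V" and y: "y \<in> V"
  shows "\<exists>L\<ge>0. ((\<lambda>s. (1 - \<rho> * s) ^ height V w * H s x y) \<longlongrightarrow> L) near \<and>
    (L > 0 \<longleftrightarrow> (\<exists>Ls. chain_between V w x y Ls \<and> length Ls = height V w))"
proof -
  let ?h = "height V w"
  let ?f = "\<lambda>s. (1 - \<rho> * s) ^ ?h * H s x y"
  obtain Q where Q: "Q \<noteq> 0"
    "\<forall>x\<in>V. \<forall>y\<in>V. \<exists>P. \<forall>s. 0 < s \<longrightarrow> s < 1 / \<rho> \<longrightarrow> poly Q s * H s x y = poly P s"
    using H_rational by (elim exE conjE)
  obtain P where PQ: "\<And>s. 0 < s \<Longrightarrow> s < 1 / \<rho> \<Longrightarrow> poly Q s * H s x y = poly P s"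
    using Q(2)[rule_format, OF x y] by (elim exE) simp
  have "eventually (\<lambda>s. poly Q s * ?f s = poly ([:1, - \<rho>:] ^ ?h * P) s) near"
  proof (rule nearI)
    fix s assume "0 < s" "s < 1 / \<rho>"
    then have "(1 - \<rho> * s) ^ ?h * (poly Q s * H s x y) = (1 - \<rho> * s) ^ ?h * poly P s"
      by (simp add: PQ)
    then show "poly Q s * ?f s = poly ([:1, - \<rho>:] ^ ?h * P) s"
      by (simp add: mult_ac poly_power)
  qed
  moreover have "?f \<in> O[near](\<lambda>_. 1)"
    using scaled_bigo[OF H_bigo_height[OF x y] order_refl] by simp
  ultimately have "\<exists>L. (?f \<longlongrightarrow> L) near"
    unfolding near_at_left by (rule rational_bounded_tendsto[OF Q(1)])
  then obtain L where L: "(?f \<longlongrightarrow> L) near" by blast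
  have "eventually (\<lambda>s. 0 \<le> ?f s) near"
    by (rule nearI) (use x y H_nonneg in simp)
  then have L0: "0 \<le> L" by (rule tendsto_lowerbound[OF L _ near_nontrivial])
  have "L > 0 \<longleftrightarrow> (\<exists>Ls. chain_between V w x y Ls \<and> length Ls = ?h)"
  proof
    assume "L > 0"
    show "\<exists>Ls. chain_between V w x y Ls \<and> length Ls = ?h"
    proof (rule ccontr)
      assume none: "\<not> ?thesis"
      \<comment> \<open>As the height is positive, \<open>?h - 1\<close> is strictly smaller than
        the exponent \<open>?h\<close>, which is what produces the limit 0.\<close>
      have "length Ls \<le> ?h - 1" if "chain_between V w x y Ls" for Ls
      proof -
        have "length Ls \<noteq> ?h" using none that by blast
        moreover have "length Ls \<le> ?h"
          using that basic_chain_length_le by (auto simp: chain_between_def)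
        ultimately show ?thesis by simp
      qed
      then have "(?f \<longlongrightarrow> 0) near"
        using x y height_pos by (intro scaled_tendsto_0[OF H_upper[of x y "?h - 1"]]) auto
      then show False using \<open>L > 0\<close> tendsto_unique[OF near_nontrivial L] by simp
    qed
  next
    assume "\<exists>Ls. chain_between V w x y Ls \<and> length Ls = ?h"
    then obtain Ls where Ls: "chain_between V w x y Ls" "length Ls = ?h" by blast
    then have "L \<noteq> 0" using scaled_tendsto_nonzero[OF _ L] H_lower[OF Ls(1) x y] by simp
    then show "L > 0" using L0 by simp
  qed
  with L L0 show ?thesis by blast
qed

lemma growth_mat_entry:
  "i < card V \<Longrightarrow> j < card V \<Longrightarrow>
    growth_mat V w s $$ (i, j) = H s (from_nat_into V i) (from_nat_into V j)"
  by (simp add: growth_mat_def H_def adj_mat_pow finite_V)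

lemma is_residual_iff:
  "is_residual V w m \<Theta> \<longleftrightarrow>
    0 < m \<and> \<Theta> \<in> carrier_mat (card V) (card V) \<and>
    (\<forall>i<card V. \<forall>j<card V. 0 \<le> \<Theta> $$ (i, j)) \<and> \<Theta> \<noteq> 0\<^sub>m (card V) (card V) \<and>
    (\<forall>i<card V. \<forall>j<card V.
      ((\<lambda>s. (1 - \<rho> * s) ^ m * H s (from_nat_into V i) (from_nat_into V j)) \<longlongrightarrow> \<Theta> $$ (i, j)) near)"
  unfolding is_residual_def near_def by (simp add: growth_mat_entry)

text \<open>If \<open>m' < m\<close>, each limit for \<open>m\<close> is that for \<open>m'\<close>
  times the limit 0 of a positive power of \<open>1 - \<rho> * s\<close>. Then
  \<open>\<Theta>\<close> would be the zero matrix, which \<open>is_residual\<close> excludes. For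
  equal exponents the limits agree entrywise.\<close>

lemma is_residual_unique:
  assumes "is_residual V w m \<Theta>" "is_residual V w m' \<Theta>'"
  shows "m = m' \<and> \<Theta> = \<Theta>'"
proof -
  have neq: "m \<le> m'" if res: "is_residual V w m \<Theta>" "is_residual V w m' \<Theta>'" for m m' \<Theta> \<Theta>'
  proof (rule ccontr)
    assume "\<not> ?thesis"
    then have m: "m' < m" by simp
    have "\<Theta> $$ (i, j) = 0" if ij: "i < card V" "j < card V" for i j
    proof -
      let ?H = "\<lambda>s. H s (from_nat_into V i) (from_nat_into V j)"
      have "((\<lambda>s. (1 - \<rho> * s) ^ (m - m') * ((1 - \<rho> * s) ^ m' * ?H s))
          \<longlongrightarrow> 0 ^ (m - m') * \<Theta>' $$ (i, j)) near"
        using res(2) ij unfolding is_residual_iff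
        by (intro tendsto_mult tendsto_power gap_tendsto) blast
      moreover have "(1 - \<rho> * s) ^ (m - m') * ((1 - \<rho> * s) ^ m' * ?H s) = (1 - \<rho> * s) ^ m * ?H s" for s
        using m by (simp add: mult.assoc[symmetric] power_add[symmetric])
      ultimately have "((\<lambda>s. (1 - \<rho> * s) ^ m * ?H s) \<longlongrightarrow> 0) near"
        using m by (simp add: zero_power)
      moreover have "((\<lambda>s. (1 - \<rho> * s) ^ m * ?H s) \<longlongrightarrow> \<Theta> $$ (i, j)) near"
        using res(1) ij unfolding is_residual_iff by blast
      ultimately show ?thesis by (rule tendsto_unique[OF near_nontrivial, rotated])
    qed
    moreover have "\<Theta> \<in> carrier_mat (card V) (card V)" "\<Theta> \<noteq> 0\<^sub>m (card V) (card V)"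
      using res(1) unfolding is_residual_iff by simp_all
    ultimately show False by auto
  qed
  have m: "m = m'" using neq[OF assms] neq[OF assms(2,1)] by simp
  have "\<Theta> $$ (i, j) = \<Theta>' $$ (i, j)" if ij: "i < card V" "j < card V" for i j
  proof (rule tendsto_unique[OF near_nontrivial])
    let ?f = "\<lambda>s. (1 - \<rho> * s) ^ m' * H s (from_nat_into V i) (from_nat_into V j)"
    show "(?f \<longlongrightarrow> \<Theta> $$ (i, j)) near" "(?f \<longlongrightarrow> \<Theta>' $$ (i, j)) near"
      using assms ij unfolding m is_residual_iff by blast+
  qed
  moreover have "\<Theta> \<in> carrier_mat (card V) (card V)" "\<Theta>' \<in> carrier_mat (card V) (card V)"
    using assms unfolding is_residual_iff by simp_all
  ultimately have "\<Theta> = \<Theta>'" by (intro eq_matI) auto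
  with m show ?thesis by simp
qed

lemma residual_exists:
  "\<exists>\<Theta>. is_residual V w (height V w) \<Theta> \<and>
    (\<forall>x\<in>V. \<forall>y\<in>V. 0 < mat_entry V \<Theta> x y \<longleftrightarrow>
      (\<exists>Ls. chain_between V w x y Ls \<and> length Ls = height V w))"
proof -
  let ?n = "card V" and ?v = "from_nat_into V"
  define L where "L x y = Lim near (\<lambda>s. (1 - \<rho> * s) ^ height V w * H s x y)" for x y
  have L: "0 \<le> L x y" "((\<lambda>s. (1 - \<rho> * s) ^ height V w * H s x y) \<longlongrightarrow> L x y) near"
    "0 < L x y \<longleftrightarrow> (\<exists>Ls. chain_between V w x y Ls \<and> length Ls = height V w)"
    if xy: "x \<in> V" "y \<in> V" for x y
  proof -
    obtain l where l: "0 \<le> l" "((\<lambda>s. (1 - \<rho> * s) ^ height V w * H s x y) \<longlongrightarrow> l) near"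
      "0 < l \<longleftrightarrow> (\<exists>Ls. chain_between V w x y Ls \<and> length Ls = height V w)"
      using H_scaled_limit[OF xy] by (elim exE conjE)
    have Ll: "L x y = l" unfolding L_def by (rule tendsto_Lim[OF near_nontrivial l(2)])
    show "0 \<le> L x y" "((\<lambda>s. (1 - \<rho> * s) ^ height V w * H s x y) \<longlongrightarrow> L x y) near"
      "0 < L x y \<longleftrightarrow> (\<exists>Ls. chain_between V w x y Ls \<and> length Ls = height V w)"
      unfolding Ll by (fact l)+
  qed
  define \<Theta> where "\<Theta> = mat ?n ?n (\<lambda>(i, j). L (?v i) (?v j))"
  have v: "?v i \<in> V" if "i < ?n" for i
    using that by (intro from_nat_into) auto
  have entry: "mat_entry V \<Theta> x y = L x y" if "x \<in> V" "y \<in> V" for x y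
    using that finite_V by (simp add: mat_entry_def \<Theta>_def to_nat_on_less countable_finite)
  \<comment> \<open>A vertex of the first class and a vertex of the last class of a dominant chain
    give a positive entry, so the limit matrix is nonzero.\<close>
  obtain Ls where Ls: "dominant_chain V w Ls" using dominant_chain_exists by blast
  then have bc: "basic_chain V w Ls" "length Ls = height V w" by (simp_all add: dominant_chain_iff)
  then have cl: "hd Ls \<in> access_classes V w" "last Ls \<in> access_classes V w"
    by (simp_all add: basic_chain_def basic_class_def)
  then obtain x y where xy: "x \<in> hd Ls" "y \<in> last Ls"
    using access_class_nonempty[OF cl(1)] access_class_nonempty[OF cl(2)] by blast
  then have V: "x \<in> V" "y \<in> V"
    using access_class_subset[OF cl(1)] access_class_subset[OF cl(2)] by auto
  have "chain_between V w x y Ls"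
    using bc(1) access_class_iff[OF cl(1) xy(1)] access_class_iff[OF cl(2) xy(2)]
    by (simp add: chain_between_def)
  then have "0 < L x y" using L(3)[OF V] bc(2) by blast
  then have "mat_entry V \<Theta> x y \<noteq> 0" unfolding entry[OF V] by simp
  moreover have "mat_entry V (0\<^sub>m ?n ?n) x y = (0 :: real)"
    using V finite_V by (simp add: mat_entry_def to_nat_on_less)
  ultimately have nz: "\<Theta> \<noteq> 0\<^sub>m ?n ?n" by metis
  have carrier: "\<Theta> \<in> carrier_mat ?n ?n" by (simp add: \<Theta>_def)
  have "\<Theta> $$ (i, j) = L (?v i) (?v j)" if "i < ?n" "j < ?n" for i j
    using that by (simp add: \<Theta>_def)
  then have "is_residual V w (height V w) \<Theta>"
    unfolding is_residual_iff using height_pos nz carrier L(1,2)[OF v v] by simp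
  moreover have "0 < mat_entry V \<Theta> x y \<longleftrightarrow>
      (\<exists>Ls. chain_between V w x y Ls \<and> length Ls = height V w)" if "x \<in> V" "y \<in> V" for x y
    unfolding entry[OF that] by (rule L(3)[OF that])
  ultimately show ?thesis by (intro exI[of _ \<Theta>] conjI ballI)
qed

end

theorem theorem4p4:
  fixes V :: "'v set" and w :: "'v \<Rightarrow> 'v \<Rightarrow> real" and h :: nat
  assumes "weighted_digraph V w"
    and "0 < graph_radius V w"
    and "h = height V w"
  shows "subexp_degree V w = h - 1 \<and>
    (\<forall>x\<in>V. \<forall>y\<in>V. 0 < mat_entry V (residual_mat V w) x y \<longleftrightarrow>
      (\<exists>Ls. dominant_chain V w Ls \<and>
        (\<forall>l\<in>hd Ls. has_access V w x l) \<and> (\<forall>l\<in>last Ls. has_access V w l y)))"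
proof -
  interpret growth V w using assms by unfold_locales
  obtain \<Theta> where \<Theta>: "is_residual V w h \<Theta>"
    "\<forall>x\<in>V. \<forall>y\<in>V. 0 < mat_entry V \<Theta> x y \<longleftrightarrow> (\<exists>Ls. chain_between V w x y Ls \<and> length Ls = h)"
    using residual_exists unfolding assms(3) by (elim exE conjE) simp
  \<comment> \<open>Uniqueness of the exponent and of the matrix evaluates both definite
    descriptions, the one for the degree and the one for the residual matrix.\<close>
  have uniq: "m = h" "\<Xi> = \<Theta>" if "is_residual V w m \<Xi>" for m \<Xi>
    using is_residual_unique[OF that \<Theta>(1)] by simp_all
  have "(THE m. \<exists>\<Theta>. is_residual V w m \<Theta>) = h"
    using \<Theta>(1) uniq(1) by (intro the_equality) blast+
  then have "subexp_degree V w = h - 1" by (simp add: subexp_degree_def)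
  moreover have "residual_mat V w = \<Theta>"
    unfolding residual_mat_def using \<Theta>(1) uniq(2) by (intro the_equality) blast+
  ultimately show ?thesis
    using \<Theta>(2) unfolding chain_between_def dominant_chain_iff assms(3) by (simp add: conj_ac)
qed

end
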